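(* Let $0<\alpha\le \pi/2$, let $\Delta=\Delta(\alpha)=\{re^{i\theta} : r\ge 0,\ |\theta|\le\alpha\}$, let $1\le p<\infty$, let $\rho:\Delta\to\mathbb{R}_+$ be an admissible weight function, and let $\{T_t\}_{t\in\Delta}$ be the translation semigroup on $X:=L^p_\rho(\Delta,\mathbb{K})$. If $$\int_\Delta \rho(s)\,ds<\infty,$$ then the translation semigroup $\{T_t\}_{t\in\Delta}$ satisfies the Frequent Hypercyclicity Criterion and is frequently hypercyclic on $X$.
   Context: $\mathbb{K}$ is the scalar field $\mathbb{R}$ or $\mathbb{C}$. A function $\rho:\Delta\to\mathbb{R}_+$ is an admissible weight function if it is measurable and there exist constants $M\ge 1$ and $\omega\in\mathbb{R}$ such that $\rho(t)\le Me^{\omega|t'|}\rho(t+t')$ for all $t,t'\in\Delta$. The space $L^p_\rho(\Delta,\mathbb{K})$ consists of the (classes of) measurable $u:\Delta\to\mathbb{K}$ with $$\|u\|_p=\left(\int_\Delta|u(\tau)|^p\rho(\tau)\,d\tau\right)^{1/p}<\infty,$$ integration being with respect to Lebesgue measure on the plane. The translation semigroup on $L^p_\rho(\Delta,\mathbb{K})$ is $(T_tf)(x):=f(x+t)$, $x,t\in\Delta$; admissibility of $\rho$ ensures that it is a well-defined $C_0$-semigroup, i.e. a family of bounded linear operators with $T_0=I$, $T_{t+s}=T_tT_s$ for all $s,t\in\Delta$, and $\lim_{s\to t}T_sf=T_tf$ for all $f\in X$, $t\in\Delta$. Let $m$ be Lebesgue measure on the plane and $\Delta_t:=\{s\in\Delta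 : |s|\le t\}$ for $t>0$. The lower density of a measurable set $A\subset\Delta$ is $$\underline{D}(A):=\liminf_{t\to\infty}\frac{m(A\cap\Delta_t)}{m(\Delta_t)}=\liminf_{t\to\infty}\frac{m(A\cap\Delta_t)}{\alpha t^2}.$$ A $C_0$-semigroup $\{T_t\}_{t\in\Delta}$ on a Banach space $X$ is frequently hypercyclic if there exists $x\in X$ such that $\underline{D}(\{t\in\Delta : T_tx\in U\})>0$ for every non-empty open set $U\subset X$. A $C_0$-semigroup $\{T_t\}_{t\in\Delta}$ on a separable Banach space $X$ satisfies the Frequent Hypercyclicity Criterion if there exist a dense subset $X_0\subset X$ and mappings $S_t:X_0\to X$, $t\in\Delta$, such that for all $x\in X_0$: (i) for any $\epsilon>0$ there exists a real number $r_\epsilon>0$ such that $$\sup\left\{\left\|\sum_{n\in J}T_{\lambda_n}S_{\mu_n}x\right\| : J \text{ is a finite set},\ |\gamma_n|\ge r_\epsilon, \text{ and } |\gamma_n-\gamma_m|\ge1,\ \forall n\ne m\right\}<\epsilon,$$ where $\lambda_n,\mu_n\in\Delta$ and $\gamma_n:=|\lambda_n-\mu_n|$; (ii) $T_tS_tx\to x$ as $t\to\infty$ (that is, as $|t|\to\infty$ with $t\in\Delta$). *)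

theory Defs
  imports "HOL-Analysis.Analysis" "HOL-Algebra.Module"
begin

section \<open>Banach spaces on explicit carriers\<close>

text \<open>
  The space in question depends on a weight, an angle and an exponent, so it cannot be an instance
  of \<open>banach\<close>. It is represented by an algebraic module with an additional norm; the
  components \<open>mult\<close> and \<open>one\<close> of the underlying ring record play no role.
\<close>

record ('k, 'a) normed_module = "('k, 'a) module" +
  vnorm :: "'a \<Rightarrow> real"

definition scalar_field :: "'k::real_normed_field ring" where
  "scalar_field = \<lparr>carrier = UNIV, mult = (*), one = 1, zero = 0, add = (+)\<rparr>"

text \<open>
  The value off the carrier is fixed to 0 because \<open>Metric_space\<close> requires
  nonnegativity and symmetry there, too.
\<close>

definition vdist :: "('k, 'a, 'm) normed_module_scheme \<Rightarrow> 'a \<Rightarrow> 'a \<Rightarrow> real" where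
  "vdist X x y = (if x \<in> carrier X \<and> y \<in> carrier X then vnorm X (x \<ominus>\<^bsub>X\<^esub> y) else 0)"

definition vtopology :: "('k, 'a, 'm) normed_module_scheme \<Rightarrow> 'a topology" where
  "vtopology X = Metric_space.mtopology (carrier X) (vdist X)"

locale normed_vector_space =
  Module.module scalar_field X
  for X :: "('k::real_normed_field, 'a, 'm) normed_module_scheme" +
  assumes vnorm_nonneg: "x \<in> carrier X \<Longrightarrow> 0 \<le> vnorm X x"
    and vnorm_eq_0_iff: "x \<in> carrier X \<Longrightarrow> vnorm X x = 0 \<longleftrightarrow> x = \<zero>\<^bsub>X\<^esub>"
    and vnorm_smult: "x \<in> carrier X \<Longrightarrow> vnorm X (a \<odot>\<^bsub>X\<^esub> x) = norm a * vnorm X x"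
    and vnorm_triangle:
      "x \<in> carrier X \<Longrightarrow> y \<in> carrier X \<Longrightarrow> vnorm X (x \<oplus>\<^bsub>X\<^esub> y) \<le> vnorm X x + vnorm X y"

locale banach_vector_space = normed_vector_space X
  for X :: "('k::real_normed_field, 'a, 'm) normed_module_scheme" +
  assumes complete: "Metric_space.mcomplete (carrier X) (vdist X)"

definition bounded_operator ::
  "('k, 'a, 'm) normed_module_scheme \<Rightarrow> ('a \<Rightarrow> 'a) \<Rightarrow> bool" where
  "bounded_operator X A \<longleftrightarrow>
     A \<in> carrier X \<rightarrow> carrier X \<and>
     (\<forall>x\<in>carrier X. \<forall>y\<in>carrier X. A (x \<oplus>\<^bsub>X\<^esub> y) = A x \<oplus>\<^bsub>X\<^esub> A y) \<and>
     (\<forall>a. \<forall>x\<in>carrier X. A (a \<odot>\<^bsub>X\<^esub> x) = a \<odot>\<^bsub>X\<^esub> A x) \<and>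
     (\<exists>C. \<forall>x\<in>carrier X. vnorm X (A x) \<le> C * vnorm X x)"

section \<open>Semigroups indexed by a complex sector\<close>

definition sector :: "real \<Rightarrow> complex set" where
  "sector \<alpha> = {of_real r * cis \<theta> |r \<theta>. 0 \<le> r \<and> \<bar>\<theta>\<bar> \<le> \<alpha>}"

locale C0_semigroup = banach_vector_space X
  for \<alpha> :: real
    and X :: "('k::real_normed_field, 'a, 'm) normed_module_scheme"
    and T :: "complex \<Rightarrow> 'a \<Rightarrow> 'a" +
  assumes bounded_operator: "t \<in> sector \<alpha> \<Longrightarrow> bounded_operator X (T t)"
    and identity: "x \<in> carrier X \<Longrightarrow> T 0 x = x"
    and semigroup:
      "t \<in> sector \<alpha> \<Longrightarrow> s \<in> sector \<alpha> \<Longrightarrow> x \<in> carrier X \<Longrightarrow> T (t + s) x = T t (T s x)"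
    and strongly_continuous:
      "t \<in> sector \<alpha> \<Longrightarrow> x \<in> carrier X \<Longrightarrow>
       limitin (vtopology X) (\<lambda>s. T s x) (T t x) (at t within sector \<alpha>)"

definition lower_density :: "real \<Rightarrow> complex set \<Rightarrow> ereal" where
  "lower_density \<alpha> A =
     Liminf at_top (\<lambda>t::real.
       ereal (measure lebesgue (A \<inter> {s \<in> sector \<alpha>. norm s \<le> t})
              / measure lebesgue {s \<in> sector \<alpha>. norm s \<le> t}))"

definition frequently_hypercyclic ::
  "real \<Rightarrow> ('k::real_normed_field, 'a, 'm) normed_module_scheme \<Rightarrow> (complex \<Rightarrow> 'a \<Rightarrow> 'a) \<Rightarrow> bool"
  where
  "frequently_hypercyclic \<alpha> X T \<longleftrightarrow>
     C0_semigroup \<alpha> X T \<and>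
     (\<exists>x\<in>carrier X. \<forall>U. openin (vtopology X) U \<and> U \<noteq> {} \<longrightarrow>
        0 < lower_density \<alpha> {t \<in> sector \<alpha>. T t x \<in> U})"

text \<open>
  In the first condition the \<open>\<gamma>\<^sub>n = \<bar>\<lambda>\<^sub>n - \<mu>\<^sub>n\<bar>\<close> are
  real numbers. The supremum is taken in the extended reals, so that it is infinite when the norms
  are unbounded.
\<close>

definition frequent_hypercyclicity_criterion ::
  "real \<Rightarrow> ('k::real_normed_field, 'a, 'm) normed_module_scheme \<Rightarrow> (complex \<Rightarrow> 'a \<Rightarrow> 'a) \<Rightarrow> bool"
  where
  "frequent_hypercyclicity_criterion \<alpha> X T \<longleftrightarrow>
     C0_semigroup \<alpha> X T \<and>
     separable_space (vtopology X) \<and>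
     (\<exists>X\<^sub>0 S. X\<^sub>0 \<subseteq> carrier X \<and>
        vtopology X closure_of X\<^sub>0 = carrier X \<and>
        (\<forall>t\<in>sector \<alpha>. S t \<in> X\<^sub>0 \<rightarrow> carrier X) \<and>
        (\<forall>x\<in>X\<^sub>0.
           (\<forall>\<epsilon>>0. \<exists>r>0.
              Sup {ereal (vnorm X (\<Oplus>\<^bsub>X\<^esub>n\<in>J. T (l n) (S (m n) x))) |(J :: nat set) l m \<gamma>.
                     finite J \<and>
                     (\<forall>n\<in>J. l n \<in> sector \<alpha> \<and> m n \<in> sector \<alpha> \<and> \<gamma> n = cmod (l n - m n)) \<and>
                     (\<forall>n\<in>J. r \<le> \<bar>\<gamma> n\<bar>) \<and>
                     (\<forall>n\<in>J. \<forall>k\<in>J. n \<noteq> k \<longrightarrow> 1 \<le> \<bar>\<gamma> n - \<gamma> k\<bar>)}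
              < ereal \<epsilon>) \<and>
           limitin (vtopology X) (\<lambda>t. T t (S t x)) x (inf at_infinity (principal (sector \<alpha>)))))"

section \<open>The weighted \<open>L\<^sup>p\<close> space and its translation semigroup\<close>

definition Lp_functions :: "'x measure \<Rightarrow> real \<Rightarrow> ('x \<Rightarrow> 'k::{real_normed_field,euclidean_space}) set"
  where
  "Lp_functions M p = {u \<in> borel_measurable M. integrable M (\<lambda>x. norm (u x) powr p)}"

definition Lp_rel :: "'x measure \<Rightarrow> real \<Rightarrow> ('x \<Rightarrow> 'k::{real_normed_field,euclidean_space}) rel"
  where
  "Lp_rel M p = {(u, v). u \<in> Lp_functions M p \<and> v \<in> Lp_functions M p \<and> (AE x in M. u x = v x)}"

text \<open>
  The elements of the space are equivalence classes of functions. Each union below collapses to a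
  single class and the image in the norm is a singleton, since the operations respect the relation.
\<close>

definition Lp_space ::
  "'x measure \<Rightarrow> real \<Rightarrow> ('k::{real_normed_field,euclidean_space}, ('x \<Rightarrow> 'k) set) normed_module"
  where
  "Lp_space M p =
     \<lparr>carrier = Lp_functions M p // Lp_rel M p,
      mult = undefined,
      one = undefined,
      zero = Lp_rel M p `` {\<lambda>x. 0},
      add = (\<lambda>c d. \<Union>u\<in>c. \<Union>v\<in>d. Lp_rel M p `` {\<lambda>x. u x + v x}),
      smult = (\<lambda>a c. \<Union>u\<in>c. Lp_rel M p `` {\<lambda>x. a * u x}),
      vnorm = (\<lambda>c. the_elem ((\<lambda>u. (\<integral>x. norm (u x) powr p \<partial>M) powr (1 / p)) ` c))\<rparr>"

definition admissible_weight :: "real \<Rightarrow> (complex \<Rightarrow> real) \<Rightarrow> bool" where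
  "admissible_weight \<alpha> \<rho> \<longleftrightarrow>
     \<rho> \<in> borel_measurable (lebesgue_on (sector \<alpha>)) \<and>
     (\<forall>t\<in>sector \<alpha>. 0 \<le> \<rho> t) \<and>
     (\<exists>M \<omega>. 1 \<le> M \<and>
        (\<forall>t\<in>sector \<alpha>. \<forall>t'\<in>sector \<alpha>. \<rho> t \<le> M * exp (\<omega> * norm t') * \<rho> (t + t')))"

text \<open>
  Integration against this measure is integration over the sector with the factor \<open>\<rho>\<close>,
  and only the values of a function on the sector matter. Where \<open>\<rho>\<close> is positive,
  equality almost everywhere is the one for Lebesgue measure; a weight vanishing on a set
  of positive measure would otherwise give a seminorm only.
\<close>

definition weighted_measure :: "real \<Rightarrow> (complex \<Rightarrow> real) \<Rightarrow> complex measure" where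
  "weighted_measure \<alpha> \<rho> = density (lebesgue_on (sector \<alpha>)) (\<lambda>x. ennreal (\<rho> x))"

definition weighted_Lp ::
  "real \<Rightarrow> (complex \<Rightarrow> real) \<Rightarrow> real \<Rightarrow>
   ('k::{real_normed_field,euclidean_space}, (complex \<Rightarrow> 'k) set) normed_module" where
  "weighted_Lp \<alpha> \<rho> p = Lp_space (weighted_measure \<alpha> \<rho>) p"

definition translation ::
  "real \<Rightarrow> (complex \<Rightarrow> real) \<Rightarrow> real \<Rightarrow> complex \<Rightarrow>
   (complex \<Rightarrow> 'k::{real_normed_field,euclidean_space}) set \<Rightarrow> (complex \<Rightarrow> 'k) set" where
  "translation \<alpha> \<rho> p t c = (\<Union>f\<in>c. Lp_rel (weighted_measure \<alpha> \<rho>) p `` {\<lambda>x. f (x + t)})"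

text \<open>
  Up to isometric isomorphism, \<^typ>\<open>real\<close> and \<^typ>\<open>complex\<close> are the only
  instances of the sort \<open>{real_normed_field,euclidean_space}\<close>, which thus renders the
  scalar field.
\<close>

end

theory Submission
  imports Defs
begin

text \<open>
  Why the theorem holds. Since the weight is integrable, the weighted measure \<open>\<mu>\<close> on the sector is finite,
  and its mass outside a disc tends to 0 as the radius grows. A bounded function of bounded support that is
  moved away from the origin therefore becomes small in norm, and so do sums of such functions as long as they
  are bounded by a fixed constant and vanish on a large disc. Both parts of the theorem rest on this remark.

  The space and the semigroup. Minkowski's inequality and completeness are proved for functions first
  (\<open>Lp_add\<close>, \<open>Lp_complete\<close>) and then transferred to classes (\<open>banach_vector_space_Lp_space\<close>). Admissibility
  of the weight bounds the translations (\<open>Lp_shift\<close>); they are strongly continuous because bounded continuous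
  functions are dense and dominated convergence applies to these (\<open>translation_continuous\<close>). A countable
  family of step functions is dense as well (\<open>step_functions_dense\<close>); its members are bounded and have
  bounded support, and it serves as the dense set in both parts of the theorem.

  The criterion. The right inverse of the translation by \<open>t\<close> shifts a step function by \<open>t\<close> into the sector.
  In the sums of the criterion the \<open>n\<close>-th term lives in an annulus of radius \<open>\<gamma> n\<close> and fixed width; the
  radii being separated, only boundedly many annuli meet in a point, so the opening remark applies
  (\<open>shifted_sum_small\<close>).

  Frequent hypercyclicity. The criterion controls sums over sets of points with separated moduli; there are
  at most of the order of \<open>t\<close> of these in the disc of radius \<open>t\<close>, while positive lower density in the plane
  calls for the order of \<open>t\<^sup>2\<close> points. So the required function is constructed directly from the opening remark.
  Let \<open>g j\<close> run through the step functions, each of them occurring with arbitrarily large \<open>j\<close>. In every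
  dyadic scale \<open>2 ^ m\<close> a vertical strip of width \<open>2 ^ (m - j - 1)\<close> is reserved for \<open>j\<close> and filled with copies of
  \<open>g j\<close> placed at the points of a lattice of mesh \<open>N j\<close> (\<open>lattice_points\<close>). If the meshes grow fast enough, then
  the translate of the pattern by a lattice point of index \<open>j\<close> is \<open>g j\<close> up to an error that tends to 0 as \<open>j\<close> grows
  (\<open>pattern_approximates\<close>). By strong continuity the same holds at the points \<open>n + s\<close>, where \<open>n\<close> is a lattice
  point and \<open>s\<close> a small element of the sector, and for each \<open>j\<close> these points have positive lower density (\<open>lower_density_pos\<close>).
\<close>

section \<open>Lebesgue spaces on the level of functions\<close>

definition Lp_norm :: "'x measure \<Rightarrow> real \<Rightarrow> ('x \<Rightarrow> 'k::{real_normed_field,euclidean_space}) \<Rightarrow> real"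
  where "Lp_norm M p u = (\<integral>x. norm (u x) powr p \<partial>M) powr (1 / p)"

locale Lp_exponent =
  fixes M :: "'x measure" and p :: real
  assumes p_ge_1: "1 \<le> p"
begin

lemma p_pos: "0 < p"
  using p_ge_1 by simp

lemma Lp_functionsD:
  assumes "u \<in> Lp_functions M p"
  shows "u \<in> borel_measurable M" "integrable M (\<lambda>x. norm (u x) powr p)"
  using assms by (auto simp: Lp_functions_def)

lemma Lp_functions_dominated:
  fixes u :: "'x \<Rightarrow> 'k::{real_normed_field,euclidean_space}"
  assumes "u \<in> borel_measurable M" "integrable M w" "AE x in M. norm (u x) powr p \<le> w x"
  shows "u \<in> Lp_functions M p"
proof -
  have "integrable M (\<lambda>x. norm (u x) powr p)"
    by (rule Bochner_Integration.integrable_bound[OF assms(2)])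
       (use assms in \<open>auto simp: powr_ge_zero elim!: eventually_mono\<close>)
  then show ?thesis using assms(1) by (simp add: Lp_functions_def)
qed

lemma Lp_norm_nonneg: "0 \<le> Lp_norm M p u"
  by (simp add: Lp_norm_def)

lemma Lp_norm_powr: "Lp_norm M p u powr p = (\<integral>x. norm (u x) powr p \<partial>M)"
  using p_pos by (simp add: Lp_norm_def powr_powr integral_nonneg_AE)

lemma nn_integral_Lp_norm:
  assumes "u \<in> Lp_functions M p"
  shows "(\<integral>\<^sup>+x. ennreal (norm (u x) powr p) \<partial>M) = ennreal (Lp_norm M p u powr p)"
  unfolding Lp_norm_powr by (rule nn_integral_eq_integral) (use Lp_functionsD[OF assms] in auto)

lemma Lp_norm_leI:
  fixes u :: "'x \<Rightarrow> 'k::{real_normed_field,euclidean_space}"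
  assumes [measurable]: "u \<in> borel_measurable M" and e: "0 \<le> e"
    and le: "(\<integral>\<^sup>+x. ennreal (norm (u x) powr p) \<partial>M) \<le> ennreal (e powr p)"
  shows "u \<in> Lp_functions M p" "Lp_norm M p u \<le> e"
proof -
  have "integrable M (\<lambda>x. norm (u x) powr p)"
    by (rule integrableI_bounded) (use le in \<open>auto simp: top.not_eq_extremum intro: le_less_trans\<close>)
  then show u: "u \<in> Lp_functions M p" by (simp add: Lp_functions_def)
  have "ennreal (Lp_norm M p u powr p) \<le> ennreal (e powr p)"
    using le nn_integral_Lp_norm[OF u] by simp
  then have "Lp_norm M p u powr p \<le> e powr p" by simp
  then show "Lp_norm M p u \<le> e"
    using e p_pos Lp_norm_nonneg[of u] powr_less_mono2[of p e "Lp_norm M p u"] by force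
qed

lemma Lp_norm_cong_AE:
  fixes u v :: "'x \<Rightarrow> 'k::{real_normed_field,euclidean_space}"
  assumes "u \<in> borel_measurable M" "v \<in> borel_measurable M" "AE x in M. norm (u x) = norm (v x)"
  shows "Lp_norm M p u = Lp_norm M p v"
proof -
  have "(\<integral>x. norm (u x) powr p \<partial>M) = (\<integral>x. norm (v x) powr p \<partial>M)"
    by (rule integral_cong_AE) (use assms in auto)
  then show ?thesis by (simp add: Lp_norm_def)
qed

lemma Lp_norm_eq_0_iff:
  assumes "u \<in> Lp_functions M p"
  shows "Lp_norm M p u = 0 \<longleftrightarrow> (AE x in M. u x = 0)"
  using integral_nonneg_eq_0_iff_AE[OF Lp_functionsD(2)[OF assms]] by (simp add: Lp_norm_def)

lemma Lp_scale:
  fixes u :: "'x \<Rightarrow> 'k::{real_normed_field,euclidean_space}"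
  assumes "u \<in> Lp_functions M p"
  shows "(\<lambda>x. a * u x) \<in> Lp_functions M p" "Lp_norm M p (\<lambda>x. a * u x) = norm a * Lp_norm M p u"
proof -
  note u = Lp_functionsD[OF assms]
  show "(\<lambda>x. a * u x) \<in> Lp_functions M p"
    using u by (auto simp: Lp_functions_def norm_mult powr_mult)
  show "Lp_norm M p (\<lambda>x. a * u x) = norm a * Lp_norm M p u"
    using p_pos by (simp add: Lp_norm_def norm_mult powr_mult powr_powr integral_nonneg_AE)
qed

lemma Lp_zero: "(\<lambda>x. 0) \<in> Lp_functions M p"
  by (simp add: Lp_functions_def)

text \<open>
  Convexity of the power function at the points \<open>s / a\<close> and \<open>t / b\<close> with the weights \<open>a / (a + b)\<close> and
  \<open>b / (a + b)\<close>. Integrating it with \<open>a\<close> and \<open>b\<close> the norms of two functions gives the inequality of Minkowski.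
\<close>

lemma powr_add_le_weighted:
  fixes s t a b :: real
  assumes "0 \<le> s" "0 \<le> t" "0 < a" "0 < b"
  shows "(s + t) powr p \<le> (a + b) powr (p - 1) * (a powr (1 - p) * s powr p + b powr (1 - p) * t powr p)"
proof -
  have zero: "t powr p \<le> (a + b) powr (p - 1) * (b powr (1 - p) * t powr p)"
    if "0 < a" "0 < b" for a b t :: real
  proof -
    have "1 \<le> ((a + b) / b) powr (p - 1)"
      by (rule ge_one_powr_ge_zero) (use that p_ge_1 in auto)
    also have "\<dots> = (a + b) powr (p - 1) * b powr (1 - p)"
      using that by (simp add: powr_divide powr_diff)
    finally show ?thesis
      using mult_right_mono[of 1 "(a + b) powr (p - 1) * b powr (1 - p)" "t powr p"]
      by (simp add: mult.assoc)
  qed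
  consider "s = 0" | "t = 0" | "0 < s" "0 < t" using assms by linarith
  then show ?thesis
  proof cases
    case 1
    then show ?thesis using zero[OF assms(3,4)] p_pos by simp
  next
    case 2
    then show ?thesis using zero[OF assms(4,3)] p_pos by (simp add: add.commute)
  next
    case 3
    let ?l = "b / (a + b)"
    have l: "1 - ?l = a / (a + b)" using assms by (simp add: field_simps)
    have "((1 - ?l) *\<^sub>R (s / a) + ?l *\<^sub>R (t / b)) powr p
        \<le> (1 - ?l) * (s / a) powr p + ?l * (t / b) powr p"
      by (rule convex_onD[OF powr_convex[OF p_ge_1]]) (use assms 3 in auto)
    also have "(1 - ?l) *\<^sub>R (s / a) + ?l *\<^sub>R (t / b) = (s + t) / (a + b)"
      unfolding l using assms by (simp add: add_divide_distrib)
    finally have *: "((s + t) / (a + b)) powr p \<le> a / (a + b) * (s / a) powr p + b / (a + b) * (t / b) powr p"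
      unfolding l .
    have ab: "(a + b) powr p / (a + b) = (a + b) powr (p - 1)"
      using assms by (simp add: powr_diff)
    have q: "a * (s / a) powr p = a powr (1 - p) * s powr p" if "0 < a" "0 < s" for a s :: real
      using that by (simp add: powr_divide powr_diff)
    have "(s + t) powr p = (a + b) powr p * ((s + t) / (a + b)) powr p"
      using assms by (simp add: powr_divide)
    also have "\<dots> \<le> (a + b) powr p * (a / (a + b) * (s / a) powr p + b / (a + b) * (t / b) powr p)"
      by (rule mult_left_mono[OF *]) simp
    also have "\<dots> = (a + b) powr p / (a + b) * (a * (s / a) powr p + b * (t / b) powr p)"
      by (simp add: distrib_left)
    finally show ?thesis unfolding ab using q assms 3 by simp
  qed
qed

lemma Lp_add:
  fixes u v :: "'x \<Rightarrow> 'k::{real_normed_field,euclidean_space}"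
  assumes u: "u \<in> Lp_functions M p" and v: "v \<in> Lp_functions M p"
  shows "(\<lambda>x. u x + v x) \<in> Lp_functions M p"
    "Lp_norm M p (\<lambda>x. u x + v x) \<le> Lp_norm M p u + Lp_norm M p v"
proof -
  note [measurable] = Lp_functionsD(1)[OF u] Lp_functionsD(1)[OF v]
  note [simp] = Lp_functionsD(2)[OF u] Lp_functionsD(2)[OF v]
  have pw: "norm (u x + v x) powr p \<le>
      (a + b) powr (p - 1) * (a powr (1 - p) * norm (u x) powr p + b powr (1 - p) * norm (v x) powr p)"
    if "0 < a" "0 < b" for a b x
    by (rule order_trans[OF powr_mono2 powr_add_le_weighted])
       (use that p_pos norm_triangle_ineq in auto)
  show uv: "(\<lambda>x. u x + v x) \<in> Lp_functions M p"
    by (rule Lp_functions_dominated[OF _ _ AE_I2[OF pw[of 1 1]]]) auto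
  note [simp] = Lp_functionsD(2)[OF uv]
  let ?A = "Lp_norm M p u" and ?B = "Lp_norm M p v"
  consider "?A = 0" | "?B = 0" | "0 < ?A" "0 < ?B"
    using Lp_norm_nonneg[of u] Lp_norm_nonneg[of v] by linarith
  then show "Lp_norm M p (\<lambda>x. u x + v x) \<le> ?A + ?B"
  proof cases
    case 1
    then have "AE x in M. u x = 0" using Lp_norm_eq_0_iff[OF u] by simp
    then have "Lp_norm M p (\<lambda>x. u x + v x) = ?B" by (intro Lp_norm_cong_AE) auto
    then show ?thesis using 1 by simp
  next
    case 2
    then have "AE x in M. v x = 0" using Lp_norm_eq_0_iff[OF v] by simp
    then have "Lp_norm M p (\<lambda>x. u x + v x) = ?A" by (intro Lp_norm_cong_AE) auto
    then show ?thesis using 2 by simp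
  next
    case 3
    have "(\<integral>x. norm (u x + v x) powr p \<partial>M) \<le> (\<integral>x. (?A + ?B) powr (p - 1) *
        (?A powr (1 - p) * norm (u x) powr p + ?B powr (1 - p) * norm (v x) powr p) \<partial>M)"
      by (rule integral_mono) (use pw 3 in \<open>auto simp: Lp_functionsD(2)[OF uv]\<close>)
    also have "\<dots> = (?A + ?B) powr (p - 1) * (?A powr (1 - p) * ?A powr p + ?B powr (1 - p) * ?B powr p)"
      by (simp add: Lp_norm_powr)
    also have "\<dots> = (?A + ?B) powr p"
      using 3 by (simp add: powr_add[symmetric] powr_mult_base mult.commute)
    finally have "Lp_norm M p (\<lambda>x. u x + v x) powr p \<le> (?A + ?B) powr p"
      unfolding Lp_norm_powr .
    then show ?thesis
      using 3 p_pos powr_less_mono2[of p "?A + ?B" "Lp_norm M p (\<lambda>x. u x + v x)"] by force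
  qed
qed

lemma Lp_diff:
  fixes u v :: "'x \<Rightarrow> 'k::{real_normed_field,euclidean_space}"
  assumes u: "u \<in> Lp_functions M p" and v: "v \<in> Lp_functions M p"
  shows "(\<lambda>x. u x - v x) \<in> Lp_functions M p"
  using Lp_add(1)[OF u Lp_scale(1)[OF v, of "-1"]] by simp

lemma Lp_norm_diff_commute:
  fixes u v :: "'x \<Rightarrow> 'k::{real_normed_field,euclidean_space}"
  shows "Lp_norm M p (\<lambda>x. u x - v x) = Lp_norm M p (\<lambda>x. v x - u x)"
  by (simp add: Lp_norm_def norm_minus_commute)

lemma Lp_norm_diff_triangle:
  fixes u v w :: "'x \<Rightarrow> 'k::{real_normed_field,euclidean_space}"
  assumes "u \<in> Lp_functions M p" "v \<in> Lp_functions M p" "w \<in> Lp_functions M p"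
  shows "Lp_norm M p (\<lambda>x. u x - w x) \<le> Lp_norm M p (\<lambda>x. u x - v x) + Lp_norm M p (\<lambda>x. v x - w x)"
  using Lp_add(2)[OF Lp_diff[OF assms(1,2)] Lp_diff[OF assms(2,3)]] by simp

lemma Lp_sum:
  fixes u :: "'i \<Rightarrow> 'x \<Rightarrow> 'k::{real_normed_field,euclidean_space}"
  assumes "\<And>i. i \<in> I \<Longrightarrow> u i \<in> Lp_functions M p"
  shows "(\<lambda>x. \<Sum>i\<in>I. u i x) \<in> Lp_functions M p"
  using assms by (induction I rule: infinite_finite_induct) (auto simp: Lp_zero intro!: Lp_add(1))

lemma Lp_norm_tendsto_0:
  fixes f :: "nat \<Rightarrow> 'x \<Rightarrow> 'k::{real_normed_field,euclidean_space}"
  assumes [measurable]: "\<And>n. f n \<in> borel_measurable M"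
    and w: "integrable M w"
    and bound: "\<And>n. AE x in M. norm (f n x) powr p \<le> w x"
    and lim: "AE x in M. (\<lambda>n. f n x) \<longlonglongrightarrow> 0"
  shows "(\<lambda>n. Lp_norm M p (f n)) \<longlonglongrightarrow> 0"
proof -
  have "(\<lambda>n. \<integral>x. norm (f n x) powr p \<partial>M) \<longlonglongrightarrow> (\<integral>x. 0 \<partial>M)"
  proof (rule integral_dominated_convergence[OF _ _ w])
    show "AE x in M. (\<lambda>n. norm (f n x) powr p) \<longlonglongrightarrow> 0"
      using lim
    proof eventually_elim
      case (elim x)
      then show ?case
        using p_pos by (intro tendsto_zero_powrI[where b = p] tendsto_norm_zero) auto
    qed
  qed (use bound in auto)
  then show ?thesis
    unfolding Lp_norm_def using p_pos by (intro tendsto_zero_powrI[where b = "1 / p"]) auto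
qed

text \<open>
  A subsequence whose consecutive differences have norm at most \<open>4 ^ - k\<close> converges almost
  everywhere: the functions \<open>(2 ^ k * D k) powr p\<close>, where \<open>D k\<close> are the moduli of the differences,
  have a finite integral in total, so almost everywhere they are bounded in \<open>k\<close> and \<open>D k\<close> decays
  geometrically. Fatou's lemma then identifies the pointwise limit as the limit in the mean.
\<close>

lemma Lp_complete:
  fixes U :: "nat \<Rightarrow> 'x \<Rightarrow> 'k::{real_normed_field,euclidean_space}"
  assumes U: "\<And>n. U n \<in> Lp_functions M p"
    and Cauchy: "\<And>e. 0 < e \<Longrightarrow> \<exists>N. \<forall>m\<ge>N. \<forall>n\<ge>N. Lp_norm M p (\<lambda>x. U m x - U n x) < e"
  shows "\<exists>u\<in>Lp_functions M p. (\<lambda>n. Lp_norm M p (\<lambda>x. U n x - u x)) \<longlonglongrightarrow> 0"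
proof -
  note [measurable] = Lp_functionsD(1)[OF U]
  have "\<forall>k. \<exists>N. \<forall>m\<ge>N. \<forall>n\<ge>N. Lp_norm M p (\<lambda>x. U m x - U n x) < (1 / 4) ^ k"
    using Cauchy by simp
  then obtain r where r: "\<And>k m n. r k \<le> m \<Longrightarrow> r k \<le> n \<Longrightarrow> Lp_norm M p (\<lambda>x. U m x - U n x) < (1 / 4) ^ k"
    by metis
  define s where "s k = (\<Sum>i\<le>k. r i)" for k
  have rs: "r k \<le> s j" if "k \<le> j" for k j
    unfolding s_def by (rule member_le_sum) (use that in auto)
  define D where "D k x = norm (U (s (Suc k)) x - U (s k) x)" for k x
  have [measurable]: "D k \<in> borel_measurable M" for k unfolding D_def by measurable
  have D: "(\<integral>\<^sup>+x. ennreal ((2 ^ k * D k x) powr p) \<partial>M) \<le> ennreal ((1 / 2) ^ k)" for k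
  proof -
    let ?d = "\<lambda>x. U (s (Suc k)) x - U (s k) x"
    have d: "?d \<in> Lp_functions M p" by (intro Lp_diff U)
    have "(\<integral>\<^sup>+x. ennreal ((2 ^ k * D k x) powr p) \<partial>M)
        = (\<integral>\<^sup>+x. ennreal (norm (2 ^ k * ?d x) powr p) \<partial>M)"
      by (simp add: D_def norm_mult norm_power)
    also have "\<dots> = ennreal (Lp_norm M p (\<lambda>x. 2 ^ k * ?d x) powr p)"
      by (rule nn_integral_Lp_norm[OF Lp_scale(1)[OF d]])
    also have "Lp_norm M p (\<lambda>x. 2 ^ k * ?d x) = 2 ^ k * Lp_norm M p ?d"
      by (simp add: Lp_scale(2)[OF d] norm_power)
    also have "ennreal (\<dots> powr p) \<le> ennreal ((1 / 2) ^ k)"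
    proof (rule ennreal_leI)
      have "2 ^ k * Lp_norm M p ?d \<le> 2 ^ k * (1 / 4) ^ k"
        using r[of k "s (Suc k)" "s k"] rs[of k "Suc k"] rs[of k k] by simp
      also have "\<dots> = (1 / 2) ^ k" by (simp add: power_mult_distrib[symmetric])
      finally have "(2 ^ k * Lp_norm M p ?d) powr p \<le> ((1 / 2) ^ k) powr p"
        using p_pos by (intro powr_mono2) (auto intro: mult_nonneg_nonneg Lp_norm_nonneg)
      also have "\<dots> \<le> ((1 / 2) ^ k) powr 1"
        by (rule powr_mono') (use p_ge_1 in \<open>auto simp: power_le_one\<close>)
      finally show "(2 ^ k * Lp_norm M p ?d) powr p \<le> (1 / 2) ^ k" by simp
    qed
    finally show ?thesis .
  qed
  have "(\<integral>\<^sup>+x. (\<Sum>k. ennreal ((2 ^ k * D k x) powr p)) \<partial>M)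
      = (\<Sum>k. \<integral>\<^sup>+x. ennreal ((2 ^ k * D k x) powr p) \<partial>M)"
    by (rule nn_integral_suminf) simp
  also have "\<dots> \<le> (\<Sum>k. ennreal ((1 / 2) ^ k))"
    by (intro suminf_le D) auto
  also have "\<dots> < \<infinity>"
    by (subst suminf_ennreal2) (auto intro: summable_geometric)
  finally have "AE x in M. (\<Sum>k. ennreal ((2 ^ k * D k x) powr p)) \<noteq> \<infinity>"
    by (intro nn_integral_noteq_infinite) auto
  then have conv: "AE x in M. convergent (\<lambda>k. U (s k) x)"
  proof eventually_elim
    case (elim x)
    then obtain C where C: "0 \<le> C" "(\<Sum>k. ennreal ((2 ^ k * D k x) powr p)) = ennreal C"
      by (metis ennreal_cases infinity_ennreal_def)
    have "D k x \<le> C powr (1 / p) * (1 / 2) ^ k" for k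
    proof -
      have "(\<Sum>k\<in>{k}. ennreal ((2 ^ k * D k x) powr p)) \<le> ennreal C"
        unfolding C(2)[symmetric] by (rule sum_le_suminf) auto
      then have "(2 ^ k * D k x) powr p \<le> C"
        using C(1) by simp
      then have "((2 ^ k * D k x) powr p) powr (1 / p) \<le> C powr (1 / p)"
        using p_pos C(1) by (intro powr_mono2) auto
      then have "2 ^ k * D k x \<le> C powr (1 / p)"
        using p_pos by (simp add: powr_powr D_def)
      then show ?thesis by (simp add: field_simps)
    qed
    then have "summable (\<lambda>k. D k x)"
      by (intro summable_comparison_test'[where N = 0, OF summable_mult[OF summable_geometric]])
        (auto simp: D_def)
    then have "summable (\<lambda>k. U (s (Suc k)) x - U (s k) x)"
      unfolding D_def by (rule summable_norm_cancel)
    then have "convergent (\<lambda>n. \<Sum>k<n. U (s (Suc k)) x - U (s k) x)"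
      by (simp add: summable_iff_convergent)
    then have "convergent (\<lambda>n. U (s n) x - U (s 0) x)"
      by (simp only: sum_lessThan_telescope[of "\<lambda>k. U (s k) x"])
    then show ?case
      using convergent_add_const_iff[of "- U (s 0) x" "\<lambda>n. U (s n) x"] by simp
  qed
  define u where "u x = lim (\<lambda>k. U (s k) x)" for x
  have [measurable]: "u \<in> borel_measurable M"
    unfolding u_def by (rule borel_measurable_lim_metric) auto
  have lim: "AE x in M. (\<lambda>k. U (s k) x) \<longlonglongrightarrow> u x"
    using conv by eventually_elim (simp add: u_def convergent_LIMSEQ_iff)
  have bd: "(\<lambda>x. U n x - u x) \<in> Lp_functions M p \<and> Lp_norm M p (\<lambda>x. U n x - u x) \<le> (1 / 4) ^ k"
    if n: "r k \<le> n" for n k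
  proof -
    have "(\<integral>\<^sup>+x. ennreal (norm (U n x - u x) powr p) \<partial>M)
        = (\<integral>\<^sup>+x. liminf (\<lambda>j. ennreal (norm (U n x - U (s j) x) powr p)) \<partial>M)"
    proof (rule nn_integral_cong_AE)
      show "AE x in M. ennreal (norm (U n x - u x) powr p)
          = liminf (\<lambda>j. ennreal (norm (U n x - U (s j) x) powr p))"
        using lim
      proof eventually_elim
        case (elim x)
        have "(\<lambda>j. norm (U n x - U (s j) x) powr p) \<longlonglongrightarrow> norm (U n x - u x) powr p"
          by (intro tendsto_powr' tendsto_norm tendsto_diff tendsto_const elim) (use p_pos in auto)
        then show ?case
          by (intro lim_imp_Liminf[symmetric] tendsto_ennrealI) auto
      qed
    qed
    also have "\<dots> \<le> liminf (\<lambda>j. \<integral>\<^sup>+x. ennreal (norm (U n x - U (s j) x) powr p) \<partial>M)"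
      by (rule nn_integral_liminf) simp
    also have "\<dots> = liminf (\<lambda>j. ennreal (Lp_norm M p (\<lambda>x. U n x - U (s j) x) powr p))"
      by (simp add: nn_integral_Lp_norm[OF Lp_diff[OF U U]])
    also have "\<dots> \<le> ennreal (((1 / 4) ^ k) powr p)"
    proof (rule Liminf_le)
      have "\<forall>\<^sub>F j in sequentially. k \<le> j" by (rule eventually_ge_at_top)
      then show "\<forall>\<^sub>F j in sequentially. ennreal (Lp_norm M p (\<lambda>x. U n x - U (s j) x) powr p)
          \<le> ennreal (((1 / 4) ^ k) powr p)"
      proof eventually_elim
        case (elim j)
        then have "Lp_norm M p (\<lambda>x. U n x - U (s j) x) < (1 / 4) ^ k"
          using r[OF n rs] by simp
        then show ?case
          using p_pos Lp_norm_nonneg by (intro ennreal_leI powr_mono2) auto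
      qed
    qed simp
    finally show ?thesis
      by (intro conjI Lp_norm_leI) auto
  qed
  have "(\<lambda>x. U (r 0) x - (U (r 0) x - u x)) \<in> Lp_functions M p"
    by (rule Lp_diff[OF U]) (use bd[of 0 "r 0"] in simp)
  then have u: "u \<in> Lp_functions M p" by simp
  have "(\<lambda>n. Lp_norm M p (\<lambda>x. U n x - u x)) \<longlonglongrightarrow> 0"
  proof (rule LIMSEQ_I)
    fix e :: real assume "0 < e"
    then obtain k where "(1 / 4) ^ k < e" using real_arch_pow_inv[of e "1/4"] by auto
    then show "\<exists>N. \<forall>n\<ge>N. norm (Lp_norm M p (\<lambda>x. U n x - u x) - 0) < e"
      using bd[of k] by (intro exI[of _ "r k"]) (auto simp: Lp_norm_nonneg intro: le_less_trans)
  qed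
  with u show ?thesis by blast
qed

end

section \<open>The Banach space of classes\<close>

definition Lp_class ::
  "'x measure \<Rightarrow> real \<Rightarrow> ('x \<Rightarrow> 'k::{real_normed_field,euclidean_space}) \<Rightarrow> ('x \<Rightarrow> 'k) set"
  where "Lp_class M p u = Lp_rel M p `` {u}"

lemma cring_scalar_field: "cring (scalar_field :: 'k::real_normed_field ring)"
proof (rule cringI)
  show "abelian_group (scalar_field :: 'k ring)"
    by (rule abelian_groupI) (auto simp: scalar_field_def intro: exI[of _ "- _"])
  show "comm_monoid (scalar_field :: 'k ring)"
    by (rule comm_monoidI) (auto simp: scalar_field_def)
qed (auto simp: scalar_field_def distrib_right)

context Lp_exponent
begin

lemma equiv_Lp_rel:
  "equiv (Lp_functions M p) (Lp_rel M p :: ('x \<Rightarrow> 'k::{real_normed_field,euclidean_space}) rel)"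
  by (rule equivI) (auto simp: Lp_rel_def refl_on_def sym_def trans_def elim!: eventually_elim2 elim: eventually_mono)

lemma Lp_class_eq_iff:
  fixes u v :: "'x \<Rightarrow> 'k::{real_normed_field,euclidean_space}"
  assumes "u \<in> Lp_functions M p" "v \<in> Lp_functions M p"
  shows "Lp_class M p u = Lp_class M p v \<longleftrightarrow> (AE x in M. u x = v x)"
  unfolding Lp_class_def using eq_equiv_class_iff[OF equiv_Lp_rel assms] assms by (simp add: Lp_rel_def)

lemma Lp_class_eqI:
  fixes u v :: "'x \<Rightarrow> 'k::{real_normed_field,euclidean_space}"
  assumes "u \<in> Lp_functions M p" "v \<in> Lp_functions M p" "AE x in M. u x = v x"
  shows "Lp_class M p u = Lp_class M p v"
  using Lp_class_eq_iff assms by blast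

lemma in_Lp_class_iff:
  "v \<in> Lp_class M p u \<longleftrightarrow> u \<in> Lp_functions M p \<and> v \<in> Lp_functions M p \<and> (AE x in M. u x = v x)"
  by (simp add: Lp_class_def Lp_rel_def)

lemma Lp_class_self: "u \<in> Lp_functions M p \<Longrightarrow> u \<in> Lp_class M p u"
  by (simp add: in_Lp_class_iff)

lemma carrier_Lp_space: "carrier (Lp_space M p) = Lp_class M p ` Lp_functions M p"
  by (auto simp: Lp_space_def quotient_def Lp_class_def)

lemma Lp_class_in_carrier: "u \<in> Lp_functions M p \<Longrightarrow> Lp_class M p u \<in> carrier (Lp_space M p)"
  by (simp add: carrier_Lp_space)

lemma Lp_space_zero: "\<zero>\<^bsub>Lp_space M p\<^esub> = Lp_class M p (\<lambda>x. 0)"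
  by (simp add: Lp_space_def Lp_class_def)

lemma Lp_space_add:
  fixes u v :: "'x \<Rightarrow> 'k::{real_normed_field,euclidean_space}"
  assumes u: "u \<in> Lp_functions M p" and v: "v \<in> Lp_functions M p"
  shows "Lp_class M p u \<oplus>\<^bsub>Lp_space M p\<^esub> Lp_class M p v = Lp_class M p (\<lambda>x. u x + v x)"
proof -
  have eq: "Lp_class M p (\<lambda>x. u' x + v' x) = Lp_class M p (\<lambda>x. u x + v x)"
    if "u' \<in> Lp_class M p u" "v' \<in> Lp_class M p v" for u' v'
    using that by (intro Lp_class_eqI Lp_add) (auto simp: in_Lp_class_iff elim!: eventually_elim2)
  have "Lp_class M p u \<oplus>\<^bsub>Lp_space M p\<^esub> Lp_class M p v
      = (\<Union>u'\<in>Lp_class M p u. \<Union>v'\<in>Lp_class M p v. Lp_class M p (\<lambda>x. u' x + v' x))"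
    by (simp add: Lp_space_def Lp_class_def)
  also have "\<dots> = Lp_class M p (\<lambda>x. u x + v x)"
    by (intro UN_constant_eq[OF Lp_class_self[OF u]] UN_constant_eq[OF Lp_class_self[OF v]] ballI eq)
  finally show ?thesis .
qed

lemma Lp_space_smult:
  fixes u :: "'x \<Rightarrow> 'k::{real_normed_field,euclidean_space}"
  assumes u: "u \<in> Lp_functions M p"
  shows "a \<odot>\<^bsub>Lp_space M p\<^esub> Lp_class M p u = Lp_class M p (\<lambda>x. a * u x)"
proof -
  have eq: "Lp_class M p (\<lambda>x. a * u' x) = Lp_class M p (\<lambda>x. a * u x)"
    if "u' \<in> Lp_class M p u" for u'
    using that by (intro Lp_class_eqI Lp_scale) (auto simp: in_Lp_class_iff simp del: mult_cancel_left elim!: eventually_mono)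
  have "a \<odot>\<^bsub>Lp_space M p\<^esub> Lp_class M p u = (\<Union>u'\<in>Lp_class M p u. Lp_class M p (\<lambda>x. a * u' x))"
    by (simp add: Lp_space_def Lp_class_def)
  also have "\<dots> = Lp_class M p (\<lambda>x. a * u x)"
    by (intro UN_constant_eq[OF Lp_class_self[OF u]] ballI eq)
  finally show ?thesis .
qed

lemma Lp_space_vnorm:
  fixes u :: "'x \<Rightarrow> 'k::{real_normed_field,euclidean_space}"
  assumes u: "u \<in> Lp_functions M p"
  shows "vnorm (Lp_space M p) (Lp_class M p u) = Lp_norm M p u"
proof -
  have "Lp_norm M p ` Lp_class M p u = {Lp_norm M p u}"
  proof (intro equalityI subsetI)
    fix y assume "y \<in> Lp_norm M p ` Lp_class M p u"
    then obtain v where v: "v \<in> Lp_class M p u" "y = Lp_norm M p v" by blast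
    then have "Lp_norm M p v = Lp_norm M p u"
      by (intro Lp_norm_cong_AE) (auto simp: in_Lp_class_iff dest: Lp_functionsD elim!: eventually_mono)
    with v show "y \<in> {Lp_norm M p u}" by simp
  qed (use Lp_class_self[OF u] in auto)
  moreover have "vnorm (Lp_space M p) (Lp_class M p u) = the_elem (Lp_norm M p ` Lp_class M p u)"
    by (simp add: Lp_space_def Lp_norm_def[abs_def])
  ultimately show ?thesis by simp
qed

lemma abelian_group_Lp_space:
  "abelian_group (Lp_space M p :: ('k::{real_normed_field,euclidean_space}, _) normed_module)"
proof (rule abelian_groupI; (unfold carrier_Lp_space)?)
  fix x assume "x \<in> Lp_class M p ` (Lp_functions M p :: ('x \<Rightarrow> 'k) set)"
  then obtain u where u: "u \<in> Lp_functions M p" "x = Lp_class M p u" by blast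
  have "(\<lambda>x. - u x) \<in> Lp_functions M p" using Lp_scale(1)[OF u(1), of "-1"] by simp
  then show "\<exists>y\<in>Lp_class M p ` Lp_functions M p. y \<oplus>\<^bsub>Lp_space M p\<^esub> x = \<zero>\<^bsub>Lp_space M p\<^esub>"
    using u by (intro bexI[of _ "Lp_class M p (\<lambda>x. - u x)"]) (auto simp: Lp_space_add Lp_space_zero)
qed (auto simp: Lp_space_add Lp_space_zero Lp_zero Lp_add ac_simps)

lemma Lp_space_minus:
  fixes u v :: "'x \<Rightarrow> 'k::{real_normed_field,euclidean_space}"
  assumes u: "u \<in> Lp_functions M p" and v: "v \<in> Lp_functions M p"
  shows "Lp_class M p u \<ominus>\<^bsub>Lp_space M p\<^esub> Lp_class M p v = Lp_class M p (\<lambda>x. u x - v x)"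
proof -
  interpret abelian_group "Lp_space M p :: ('k, _) normed_module"
    by (rule abelian_group_Lp_space)
  have v': "(\<lambda>x. - v x) \<in> Lp_functions M p" using Lp_scale(1)[OF v, of "-1"] by simp
  have "\<ominus>\<^bsub>Lp_space M p\<^esub> Lp_class M p v = Lp_class M p (\<lambda>x. - v x)"
    by (rule minus_equality) (auto simp: Lp_space_add v v' Lp_space_zero carrier_Lp_space)
  then show ?thesis by (simp add: a_minus_def Lp_space_add u v')
qed

lemma vdist_Lp_space:
  fixes u v :: "'x \<Rightarrow> 'k::{real_normed_field,euclidean_space}"
  assumes "u \<in> Lp_functions M p" "v \<in> Lp_functions M p"
  shows "vdist (Lp_space M p) (Lp_class M p u) (Lp_class M p v) = Lp_norm M p (\<lambda>x. u x - v x)"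
  using assms by (simp add: vdist_def carrier_Lp_space Lp_space_minus Lp_space_vnorm Lp_diff)

lemma Lp_space_finsum:
  fixes u :: "'i \<Rightarrow> 'x \<Rightarrow> 'k::{real_normed_field,euclidean_space}"
  assumes "finite I" "\<And>i. i \<in> I \<Longrightarrow> u i \<in> Lp_functions M p"
  shows "(\<Oplus>\<^bsub>Lp_space M p\<^esub>i\<in>I. Lp_class M p (u i)) = Lp_class M p (\<lambda>x. \<Sum>i\<in>I. u i x)"
proof -
  interpret abelian_group "Lp_space M p :: ('k, _) normed_module"
    by (rule abelian_group_Lp_space)
  show ?thesis
    using assms
  proof (induction I)
    case empty
    then show ?case by (simp add: Lp_space_zero)
  next
    case (insert i I)
    then have "(\<Oplus>\<^bsub>Lp_space M p\<^esub>i\<in>insert i I. Lp_class M p (u i))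
        = Lp_class M p (u i) \<oplus>\<^bsub>Lp_space M p\<^esub> Lp_class M p (\<lambda>x. \<Sum>i\<in>I. u i x)"
      by (subst finsum_insert) (auto simp: carrier_Lp_space)
    then show ?case using insert by (simp add: Lp_space_add Lp_sum)
  qed
qed

lemma normed_vector_space_Lp_space:
  "normed_vector_space (Lp_space M p :: ('k::{real_normed_field,euclidean_space}, _) normed_module)"
proof -
  have "Module.module scalar_field (Lp_space M p :: ('k, _) normed_module)"
  proof (rule Module.moduleI[OF cring_scalar_field abelian_group_Lp_space]; unfold carrier_Lp_space)
  qed (auto simp: scalar_field_def Lp_space_smult Lp_space_add Lp_scale Lp_add distrib_left distrib_right mult.assoc)
  moreover have "normed_vector_space_axioms (Lp_space M p :: ('k, _) normed_module)"
  proof (rule normed_vector_space_axioms.intro; unfold carrier_Lp_space)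
    fix x y :: "('x \<Rightarrow> 'k) set" and a :: 'k
    assume "x \<in> Lp_class M p ` Lp_functions M p"
    then obtain u where u: "u \<in> Lp_functions M p" "x = Lp_class M p u" by blast
    show "0 \<le> vnorm (Lp_space M p) x" using u by (simp add: Lp_space_vnorm Lp_norm_nonneg)
    show "vnorm (Lp_space M p) x = 0 \<longleftrightarrow> x = \<zero>\<^bsub>Lp_space M p\<^esub>"
      using u by (simp add: Lp_space_vnorm Lp_space_zero Lp_class_eq_iff Lp_zero Lp_norm_eq_0_iff)
    show "vnorm (Lp_space M p) (a \<odot>\<^bsub>Lp_space M p\<^esub> x) = norm a * vnorm (Lp_space M p) x"
      using u by (simp add: Lp_space_vnorm Lp_space_smult Lp_scale)
    assume "y \<in> Lp_class M p ` Lp_functions M p"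
    then obtain v where v: "v \<in> Lp_functions M p" "y = Lp_class M p v" by blast
    show "vnorm (Lp_space M p) (x \<oplus>\<^bsub>Lp_space M p\<^esub> y) \<le> vnorm (Lp_space M p) x + vnorm (Lp_space M p) y"
      using u v by (simp add: Lp_space_vnorm Lp_space_add Lp_add)
  qed
  ultimately show ?thesis by (rule normed_vector_space.intro)
qed

lemma Metric_space_Lp_space:
  "Metric_space (carrier (Lp_space M p :: ('k::{real_normed_field,euclidean_space}, _) normed_module))
     (vdist (Lp_space M p))"
proof
  fix x y z :: "('x \<Rightarrow> 'k) set"
  note simps = carrier_Lp_space vdist_Lp_space
  show "0 \<le> vdist (Lp_space M p) x y"
    by (cases "x \<in> carrier (Lp_space M p) \<and> y \<in> carrier (Lp_space M p)")
       (auto simp: simps Lp_norm_nonneg, auto simp: vdist_def carrier_Lp_space)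
  show "vdist (Lp_space M p) x y = vdist (Lp_space M p) y x"
    by (cases "x \<in> carrier (Lp_space M p) \<and> y \<in> carrier (Lp_space M p)")
       (auto simp: simps intro: Lp_norm_diff_commute, auto simp: vdist_def carrier_Lp_space)
  assume "x \<in> carrier (Lp_space M p)" "y \<in> carrier (Lp_space M p)"
  then obtain u v where u: "u \<in> Lp_functions M p" "x = Lp_class M p u"
    and v: "v \<in> Lp_functions M p" "y = Lp_class M p v" by (auto simp: carrier_Lp_space)
  show "vdist (Lp_space M p) x y = 0 \<longleftrightarrow> x = y"
    using u v by (simp add: simps Lp_norm_eq_0_iff Lp_diff Lp_class_eq_iff)
  assume "z \<in> carrier (Lp_space M p)"
  then obtain w where w: "w \<in> Lp_functions M p" "z = Lp_class M p w" by (auto simp: carrier_Lp_space)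
  show "vdist (Lp_space M p) x z \<le> vdist (Lp_space M p) x y + vdist (Lp_space M p) y z"
    using u v w by (simp add: simps Lp_norm_diff_triangle)
qed

lemma limitin_Lp_space:
  fixes f :: "'i \<Rightarrow> 'x \<Rightarrow> 'k::{real_normed_field,euclidean_space}"
  assumes u: "u \<in> Lp_functions M p" and f: "\<forall>\<^sub>F s in F. f s \<in> Lp_functions M p"
    and lim: "((\<lambda>s. Lp_norm M p (\<lambda>x. f s x - u x)) \<longlongrightarrow> 0) F"
  shows "limitin (vtopology (Lp_space M p)) (\<lambda>s. Lp_class M p (f s)) (Lp_class M p u) F"
proof -
  interpret Metric_space "carrier (Lp_space M p :: ('k, _) normed_module)" "vdist (Lp_space M p)"
    by (rule Metric_space_Lp_space)
  have "((\<lambda>s. vdist (Lp_space M p) (Lp_class M p (f s)) (Lp_class M p u)) \<longlongrightarrow> 0) F"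
    by (rule Lim_transform_eventually[OF lim], rule eventually_mono[OF f]) (simp add: vdist_Lp_space u)
  then show ?thesis
    unfolding vtopology_def limitin_metric_dist_null
    using u f by (auto simp: carrier_Lp_space elim: eventually_mono)
qed

theorem banach_vector_space_Lp_space:
  "banach_vector_space (Lp_space M p :: ('k::{real_normed_field,euclidean_space}, _) normed_module)"
proof (rule banach_vector_space.intro[OF normed_vector_space_Lp_space], unfold_locales)
  interpret Metric_space "carrier (Lp_space M p :: ('k, _) normed_module)" "vdist (Lp_space M p)"
    by (rule Metric_space_Lp_space)
  show "mcomplete"
    unfolding mcomplete_def
  proof (intro allI impI)
    fix c :: "nat \<Rightarrow> ('x \<Rightarrow> 'k) set" assume c: "MCauchy c"
    then have "range c \<subseteq> carrier (Lp_space M p)" unfolding MCauchy_def by blast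
    then have "\<forall>n. \<exists>u. u \<in> Lp_functions M p \<and> c n = Lp_class M p u"
      unfolding carrier_Lp_space by blast
    then obtain U where U: "\<And>n. U n \<in> Lp_functions M p" "\<And>n. c n = Lp_class M p (U n)" by metis
    have "\<exists>N. \<forall>m\<ge>N. \<forall>n\<ge>N. Lp_norm M p (\<lambda>x. U m x - U n x) < e" if "0 < e" for e
    proof -
      obtain N where "\<forall>n n'. N \<le> n \<longrightarrow> N \<le> n' \<longrightarrow> vdist (Lp_space M p) (c n) (c n') < e"
        using c \<open>0 < e\<close> unfolding MCauchy_def by blast
      then show ?thesis by (intro exI[of _ N]) (simp add: U vdist_Lp_space)
    qed
    from Lp_complete[OF U(1) this] obtain u where
      "u \<in> Lp_functions M p" "(\<lambda>n. Lp_norm M p (\<lambda>x. U n x - u x)) \<longlonglongrightarrow> 0" by blast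
    then have "limitin mtopology (\<lambda>n. Lp_class M p (U n)) (Lp_class M p u) sequentially"
      using limitin_Lp_space[of u U sequentially] U(1) unfolding vtopology_def by simp
    moreover have "c = (\<lambda>n. Lp_class M p (U n))" using U(2) by auto
    ultimately show "\<exists>x. limitin mtopology c x sequentially" by blast
  qed
qed

lemma closure_Lp_space_eq_carrierI:
  fixes G :: "('x \<Rightarrow> 'k::{real_normed_field,euclidean_space}) set"
  assumes G: "G \<subseteq> Lp_functions M p"
    and dense: "\<And>u e. u \<in> Lp_functions M p \<Longrightarrow> 0 < e \<Longrightarrow> \<exists>g\<in>G. Lp_norm M p (\<lambda>x. u x - g x) < e"
  shows "vtopology (Lp_space M p) closure_of (Lp_class M p ` G) = carrier (Lp_space M p)"
proof -
  interpret Metric_space "carrier (Lp_space M p :: ('k, _) normed_module)" "vdist (Lp_space M p)"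
    by (rule Metric_space_Lp_space)
  show ?thesis
    unfolding vtopology_def metric_closure_of
  proof (intro equalityI subsetI CollectI conjI allI impI)
    fix c :: "('x \<Rightarrow> 'k) set" and r :: real
    assume c: "c \<in> carrier (Lp_space M p)" and r: "0 < r"
    then obtain u where u: "u \<in> Lp_functions M p" "c = Lp_class M p u" by (auto simp: carrier_Lp_space)
    from dense[OF u(1) r] obtain g where "g \<in> G" "Lp_norm M p (\<lambda>x. u x - g x) < r" by blast
    then show "\<exists>y\<in>Lp_class M p ` G. y \<in> mball c r"
      using u(1) c G unfolding u(2) by (intro bexI[of _ "Lp_class M p g"])
        (auto simp: in_mball vdist_Lp_space Lp_class_in_carrier subset_iff)
  qed auto
qed

lemma openin_Lp_space_ball:
  fixes u :: "'x \<Rightarrow> 'k::{real_normed_field,euclidean_space}"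
  assumes "openin (vtopology (Lp_space M p)) V" "Lp_class M p u \<in> V" "u \<in> Lp_functions M p"
  obtains e where "0 < e" 
    "\<And>v. v \<in> Lp_functions M p \<Longrightarrow> Lp_norm M p (\<lambda>x. u x - v x) < e \<Longrightarrow> Lp_class M p v \<in> V"
proof -
  interpret Metric_space "carrier (Lp_space M p :: ('k, _) normed_module)" "vdist (Lp_space M p)"
    by (rule Metric_space_Lp_space)
  obtain e where "0 < e" "mball (Lp_class M p u) e \<subseteq> V"
    using assms unfolding vtopology_def openin_mtopology by blast
  then show thesis
    using assms(3) by (intro that[of e]) (auto simp: subset_iff Lp_class_in_carrier vdist_Lp_space)
qed

end

section \<open>Approximation for an integrable weight\<close>

locale integrable_weight =
  fixes S :: "complex set" and \<rho> :: "complex \<Rightarrow> real" and p :: real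
  assumes S_lebesgue: "S \<in> sets lebesgue"
    and \<rho>_measurable [measurable]: "\<rho> \<in> borel_measurable (lebesgue_on S)"
    and \<rho>_integrable: "(\<integral>\<^sup>+ s. ennreal (\<rho> s) \<partial>lebesgue_on S) < \<infinity>"
    and exponent_ge_1: "1 \<le> p"
begin

abbreviation (input) "\<mu> \<equiv> density (lebesgue_on S) (\<lambda>x. ennreal (\<rho> x))"

sublocale Lp_exponent \<mu> p
  by unfold_locales (rule exponent_ge_1)

sublocale finite_measure \<mu>
proof
  have "emeasure \<mu> (space \<mu>) = (\<integral>\<^sup>+ s. ennreal (\<rho> s) \<partial>lebesgue_on S)"
    by (subst emeasure_density) (auto intro!: nn_integral_cong)
  then show "emeasure \<mu> (space \<mu>) \<noteq> \<infinity>" using \<rho>_integrable by simp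
qed

lemma borel_imp_measurable_mu: "u \<in> measurable borel N \<Longrightarrow> u \<in> measurable \<mu> N"
  by (simp add: measurable_restrict_space1 measurable_completion)

lemma AE_mu: "AE x in lebesgue_on S. P x \<Longrightarrow> AE x in \<mu>. P x"
  by (subst AE_density) (auto elim: eventually_mono)

lemma bounded_in_Lp:
  fixes u :: "complex \<Rightarrow> 'k::{real_normed_field,euclidean_space}"
  assumes "u \<in> borel_measurable \<mu>" "\<And>x. x \<in> S \<Longrightarrow> norm (u x) \<le> B"
  shows "u \<in> Lp_functions \<mu> p"
  by (rule Lp_functions_dominated[OF assms(1), where w = "\<lambda>_. B powr p"])
     (use assms(2) p_pos in \<open>auto intro!: AE_I2 powr_mono2\<close>)

lemma Lp_norm_tendsto_0_bounded:
  fixes f :: "nat \<Rightarrow> complex \<Rightarrow> 'k::{real_normed_field,euclidean_space}"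
  assumes "\<And>n. f n \<in> borel_measurable \<mu>" "\<And>n x. x \<in> S \<Longrightarrow> norm (f n x) \<le> B"
    and "AE x in lebesgue_on S. (\<lambda>n. f n x) \<longlonglongrightarrow> 0"
  shows "(\<lambda>n. Lp_norm \<mu> p (f n)) \<longlonglongrightarrow> 0"
  by (rule Lp_norm_tendsto_0[where w = "\<lambda>_. B powr p"])
     (use assms p_pos in \<open>auto intro!: AE_I2 powr_mono2 AE_mu\<close>)

lemma eventually_Lp_norm_less:
  assumes "(\<lambda>n. Lp_norm \<mu> p (f n)) \<longlonglongrightarrow> 0" "0 < e"
  obtains n :: nat where "Lp_norm \<mu> p (f n) < e"
  using order_tendstoD(2)[OF assms] by (auto simp: eventually_sequentially)

lemma truncation_dense:
  fixes u :: "complex \<Rightarrow> 'k::{real_normed_field,euclidean_space}"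
  assumes u: "u \<in> Lp_functions \<mu> p" and e: "0 < e"
  obtains v B where "v \<in> borel_measurable \<mu>" "0 \<le> B" "\<And>x. norm (v x) \<le> B"
    "Lp_norm \<mu> p (\<lambda>x. u x - v x) < e"
proof -
  define v where "v n x = (if norm (u x) \<le> real n then u x else 0)" for n x
  have [measurable]: "u \<in> borel_measurable \<mu>" using Lp_functionsD[OF u] by simp
  have v: "v n \<in> borel_measurable \<mu>" for n unfolding v_def by measurable
  note [measurable] = v
  have "(\<lambda>n. Lp_norm \<mu> p (\<lambda>x. u x - v n x)) \<longlonglongrightarrow> 0"
  proof (rule Lp_norm_tendsto_0[OF _ Lp_functionsD(2)[OF u]])
    show "AE x in \<mu>. (\<lambda>n. u x - v n x) \<longlonglongrightarrow> 0"
    proof (rule AE_I2)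
      fix x
      obtain N :: nat where "norm (u x) \<le> real N" using real_arch_simple by blast
      then have "\<forall>\<^sub>F n in sequentially. u x - v n x = 0"
        unfolding eventually_sequentially v_def by (intro exI[of _ N]) auto
      then show "(\<lambda>n. u x - v n x) \<longlonglongrightarrow> 0" by (rule tendsto_eventually)
    qed
  qed (auto simp: v_def)
  from eventually_Lp_norm_less[OF this e] obtain n where "Lp_norm \<mu> p (\<lambda>x. u x - v n x) < e" .
  then show thesis using v by (intro that[of "v n" "real n"]) (auto simp: v_def)
qed

text \<open>
  A Lebesgue measurable function is almost everywhere a limit of continuous functions; cutting these
  off radially at a bound of the function makes the convergence dominated.
\<close>

lemma bounded_continuous_dense:
  fixes u :: "complex \<Rightarrow> 'k::{real_normed_field,euclidean_space}"
  assumes u: "u \<in> Lp_functions \<mu> p" and e: "0 < e"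
  obtains g B where "continuous_on UNIV g" "\<And>x. norm (g x) \<le> B" "Lp_norm \<mu> p (\<lambda>x. u x - g x) < e"
proof -
  from truncation_dense[OF u, of "e / 2"] e obtain v B where v: "v \<in> borel_measurable \<mu>"
    and B: "0 \<le> B" "\<And>x. norm (v x) \<le> B" and uv: "Lp_norm \<mu> p (\<lambda>x. u x - v x) < e / 2"
    by (metis half_gt_zero)
  have "v measurable_on S"
    using v measurable_on_iff_borel_measurable[OF S_lebesgue, of v] by simp
  then obtain N g where N: "negligible N" and g: "\<And>n. continuous_on UNIV (g n)"
    and lim: "\<And>x. x \<notin> N \<Longrightarrow> (\<lambda>n. g n x) \<longlonglongrightarrow> (if x \<in> S then v x else 0)"
    unfolding measurable_on_def by blast
  \<comment> \<open>Cutting off at \<open>B + 1\<close> keeps the denominator positive if \<open>B = 0\<close>.\<close>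
  define c :: "'k \<Rightarrow> 'k" where "c y = ((B + 1) / max (B + 1) (norm y)) *\<^sub>R y" for y
  have c_cont: "continuous_on UNIV c"
    unfolding c_def by (intro continuous_intros) (use B in auto)
  have c_bound: "norm (c y) \<le> B + 1" for y
  proof -
    have "norm (c y) = (B + 1) * (norm y / max (B + 1) (norm y))" using B by (simp add: c_def)
    also have "\<dots> \<le> (B + 1) * 1"
      using B by (intro mult_left_mono) (auto simp: divide_le_eq_1 max_def)
    finally show ?thesis by simp
  qed
  have c_id: "c (v x) = v x" for x
    using B(1) B(2)[of x] by (auto simp: c_def max_def)
  have cg: "continuous_on UNIV (\<lambda>x. c (g n x))" for n
    by (rule continuous_on_compose2[OF c_cont g]) auto
  have cg_m: "(\<lambda>x. c (g n x)) \<in> borel_measurable \<mu>" for n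
    by (intro borel_imp_measurable_mu borel_measurable_continuous_onI cg)
  note [measurable] = v cg_m
  have "(\<lambda>n. Lp_norm \<mu> p (\<lambda>x. v x - c (g n x))) \<longlonglongrightarrow> 0"
  proof (rule Lp_norm_tendsto_0_bounded[where B = "B + (B + 1)"])
    show "norm (v x - c (g n x)) \<le> B + (B + 1)" for n x
      using norm_triangle_ineq4[of "v x" "c (g n x)"] B(2)[of x] c_bound[of "g n x"] by linarith
    have "AE x in lebesgue. x \<notin> N"
      using N by (auto simp: negligible_iff_null_sets intro: AE_not_in)
    then have "AE x in lebesgue_on S. x \<notin> N"
      using S_lebesgue by (auto simp: AE_restrict_space_iff elim: eventually_mono)
    moreover have "AE x in lebesgue_on S. x \<in> S" by (auto intro: AE_I2)
    ultimately show "AE x in lebesgue_on S. (\<lambda>n. v x - c (g n x)) \<longlonglongrightarrow> 0"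
    proof eventually_elim
      case (elim x)
      then have "(\<lambda>n. c (g n x)) \<longlonglongrightarrow> c (v x)"
        using continuous_on_tendsto_compose[OF c_cont lim[of x]] by simp
      then show ?case using tendsto_diff[OF tendsto_const[of "v x"]] c_id[of x] by fastforce
    qed
  qed measurable
  from eventually_Lp_norm_less[OF this, of "e / 2"] e
  obtain n where n: "Lp_norm \<mu> p (\<lambda>x. v x - c (g n x)) < e / 2" by auto
  have "Lp_norm \<mu> p (\<lambda>x. u x - c (g n x)) < e"
    using Lp_norm_diff_triangle[OF u bounded_in_Lp[OF v B(2)] bounded_in_Lp[OF cg_m c_bound], of n] uv n
    by linarith
  then show thesis using cg c_bound by (intro that[of "\<lambda>x. c (g n x)" "B + 1"])
qed

end

subsection \<open>Step functions on square grids\<close>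

text \<open>
  The cells of the grid of mesh \<open>1 / (k + 1)\<close> are numbered, and a step function is given by the list of
  its values on an initial segment of the cells. Lists over a countable set of values therefore give a
  countable set of functions, all of them bounded and of bounded support.
\<close>

definition grid_cell :: "nat \<Rightarrow> complex \<Rightarrow> nat" where
  "grid_cell k x = to_nat (\<lfloor>real (Suc k) * Re x\<rfloor>, \<lfloor>real (Suc k) * Im x\<rfloor>)"

definition grid_corner :: "nat \<Rightarrow> nat \<Rightarrow> complex" where
  "grid_corner k n = (case from_nat n :: int \<times> int of (a, b) \<Rightarrow>
     Complex (of_int a / real (Suc k)) (of_int b / real (Suc k)))"

definition step_function :: "nat \<Rightarrow> 'k::zero list \<Rightarrow> complex \<Rightarrow> 'k" where
  "step_function k l x = (if grid_cell k x < length l then l ! grid_cell k x else 0)"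

definition step_functions :: "'k::zero set \<Rightarrow> (complex \<Rightarrow> 'k) set" where
  "step_functions D = (\<lambda>(k, l). step_function k l) ` (UNIV \<times> lists D)"

lemma countable_step_functions: "countable D \<Longrightarrow> countable (step_functions D)"
  by (auto simp: step_functions_def)

lemma step_functions_nonempty: "step_functions D \<noteq> {}"
  by (auto simp: step_functions_def)

lemma dist_grid_corner: "dist (grid_corner k (grid_cell k x)) x \<le> 2 / real (Suc k)"
proof -
  have *: "\<bar>of_int \<lfloor>real (Suc k) * r\<rfloor> / real (Suc k) - r\<bar> \<le> 1 / real (Suc k)" for r
  proof -
    have "of_int \<lfloor>real (Suc k) * r\<rfloor> / real (Suc k) - r
        = (of_int \<lfloor>real (Suc k) * r\<rfloor> - real (Suc k) * r) / real (Suc k)"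
      by (simp add: diff_divide_distrib)
    moreover have "\<bar>of_int \<lfloor>real (Suc k) * r\<rfloor> - real (Suc k) * r\<bar> \<le> 1" by linarith
    ultimately show ?thesis by (simp add: divide_right_mono del: of_nat_Suc)
  qed
  have "dist (grid_corner k (grid_cell k x)) x \<le>
      \<bar>Re (grid_corner k (grid_cell k x) - x)\<bar> + \<bar>Im (grid_corner k (grid_cell k x) - x)\<bar>"
    unfolding dist_norm by (rule cmod_le)
  also have "\<dots> \<le> 1 / real (Suc k) + 1 / real (Suc k)"
    unfolding grid_corner_def grid_cell_def using *[of "Re x"] *[of "Im x"]
    by (intro add_mono) simp_all
  finally show ?thesis by simp
qed

lemma grid_corner_tendsto: "(\<lambda>k. grid_corner k (grid_cell k x)) \<longlonglongrightarrow> x"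
proof (rule metric_tendsto_imp_tendsto)
  show "(\<lambda>k. 2 / real (Suc k)) \<longlonglongrightarrow> 0"
    using LIMSEQ_Suc[OF lim_const_over_n[of 2]] by simp
  show "\<forall>\<^sub>F k in sequentially. dist (grid_corner k (grid_cell k x)) x \<le> dist (2 / real (Suc k)) 0"
    using dist_grid_corner[of _ x] by (simp add: dist_norm)
qed

lemma measurable_grid_cell [measurable]: "grid_cell k \<in> measurable borel (count_space UNIV)"
proof -
  have [measurable]: "(\<lambda>x. \<lfloor>real (Suc k) * Re x\<rfloor>) \<in> measurable borel (count_space UNIV)"
    "(\<lambda>x. \<lfloor>real (Suc k) * Im x\<rfloor>) \<in> measurable borel (count_space UNIV)" by measurable
  show ?thesis unfolding grid_cell_def[abs_def] by measurable
qed

lemma borel_measurable_step_function [measurable]: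
  "step_function k (l :: 'k::{zero,topological_space} list) \<in> borel_measurable borel"
proof -
  have "(\<lambda>n. if n < length l then l ! n else 0) \<circ> grid_cell k \<in> measurable borel borel"
    by (rule measurable_comp[OF measurable_grid_cell]) simp
  then show ?thesis by (simp add: step_function_def[abs_def] comp_def)
qed

lemma step_function_bounded:
  obtains B R where "0 < B" "0 < R" "\<And>x. norm (step_function k l x :: 'k::real_normed_vector) \<le> B"
    "\<And>x. step_function k l x \<noteq> 0 \<Longrightarrow> norm x \<le> R"
proof
  let ?B = "1 + (\<Sum>y\<leftarrow>l. norm y)" and ?R = "2 + (\<Sum>n<length l. norm (grid_corner k n))"
  have pos: "0 \<le> (\<Sum>y\<leftarrow>l. norm y)" by (rule sum_list_nonneg) auto
  show "0 < ?B" using pos by simp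
  show "0 < ?R" by (intro add_pos_nonneg sum_nonneg) auto
  fix x
  have "norm y \<le> (\<Sum>y\<leftarrow>l. norm y)" if "y \<in> set l" for y
    by (rule member_le_sum_list) (use that in auto)
  from this[OF nth_mem] show "norm (step_function k l x) \<le> ?B"
    using pos by (auto simp: step_function_def add_increasing)
  assume "step_function k l x \<noteq> 0"
  then have "grid_cell k x < length l" by (auto simp: step_function_def split: if_splits)
  then have "norm (grid_corner k (grid_cell k x)) \<le> (\<Sum>n<length l. norm (grid_corner k n))"
    by (intro member_le_sum) auto
  moreover have "2 / real (Suc k) \<le> 2" by (simp add: field_simps)
  then have "norm x \<le> norm (grid_corner k (grid_cell k x)) + 2"
    using dist_grid_corner[of k x] norm_triangle_ineq2[of x "grid_corner k (grid_cell k x)"]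
    unfolding dist_norm by (metis (no_types, opaque_lifting) add.commute diff_le_eq norm_minus_commute order_trans)
  ultimately show "norm x \<le> ?R" by simp
qed

context integrable_weight
begin

lemma step_functions_in_Lp:
  fixes g :: "complex \<Rightarrow> 'k::{real_normed_field,euclidean_space}"
  assumes "g \<in> step_functions D"
  shows "g \<in> Lp_functions \<mu> p"
proof -
  from assms obtain k l where g: "g = step_function k l" by (auto simp: step_functions_def)
  obtain B where "\<And>x. norm (step_function k l x) \<le> B"
    by (rule step_function_bounded[where k = k and l = l]) blast
  then show ?thesis unfolding g by (intro bounded_in_Lp borel_imp_measurable_mu) auto
qed

text \<open>
  A bounded continuous function is the limit of its values at the corners of the cells; these values are
  rounded to elements of \<open>D\<close>, and finally all but finitely many cells are dropped. Each of the steps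
  is a bounded pointwise limit, hence a limit in the mean because the measure is finite.
\<close>

lemma step_functions_dense:
  fixes u :: "complex \<Rightarrow> 'k::{real_normed_field,euclidean_space}"
  assumes D: "\<And>V. open V \<Longrightarrow> V \<noteq> {} \<Longrightarrow> \<exists>d\<in>D. d \<in> V"
    and u: "u \<in> Lp_functions \<mu> p" and e: "0 < e"
  shows "\<exists>g\<in>step_functions D. Lp_norm \<mu> p (\<lambda>x. u x - g x) < e"
proof -
  from e have e3: "0 < e / 3" by simp
  obtain g B where g: "continuous_on UNIV g" and B: "\<And>x. norm (g x) \<le> B"
    and ug: "Lp_norm \<mu> p (\<lambda>x. u x - g x) < e / 3"
    using bounded_continuous_dense[OF u e3] by metis
  have "\<forall>k y. \<exists>d. d \<in> D \<and> dist d y < 1 / real (Suc k)"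
  proof (intro allI)
    fix k and y :: 'k
    show "\<exists>d. d \<in> D \<and> dist d y < 1 / real (Suc k)"
      using D[of "ball y (1 / real (Suc k))"] by (auto simp: dist_commute)
  qed
  then obtain near where near: "\<And>k y. near k y \<in> D" "\<And>k y. dist (near k y) y < 1 / real (Suc k)"
    by metis
  define \<phi> where "\<phi> k n = near k (g (grid_corner k n))" for k n
  have \<phi>_bound: "norm (\<phi> k n) \<le> B + 1" for k n
  proof -
    have "norm (\<phi> k n) \<le> norm (g (grid_corner k n)) + dist (\<phi> k n) (g (grid_corner k n))"
      by (metis dist_norm norm_triangle_sub)
    moreover have "dist (\<phi> k n) (g (grid_corner k n)) < 1"
      unfolding \<phi>_def using near(2)[of k "g (grid_corner k n)"]
      by (rule less_le_trans) (simp add: field_simps)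
    ultimately show ?thesis using B[of "grid_corner k n"] by linarith
  qed
  have gm: "g \<in> borel_measurable \<mu>"
    by (intro borel_imp_measurable_mu borel_measurable_continuous_onI g)
  have \<phi>m: "(\<lambda>x. \<phi> k (grid_cell k x)) \<in> borel_measurable \<mu>" for k
    by (rule borel_imp_measurable_mu) measurable
  note [measurable] = gm \<phi>m
  have "(\<lambda>k. Lp_norm \<mu> p (\<lambda>x. g x - \<phi> k (grid_cell k x))) \<longlonglongrightarrow> 0"
  proof (rule Lp_norm_tendsto_0_bounded[where B = "B + (B + 1)"])
    show "norm (g x - \<phi> k (grid_cell k x)) \<le> B + (B + 1)" for k x
      using norm_triangle_ineq4[of "g x" "\<phi> k (grid_cell k x)"] B[of x] \<phi>_bound[of k "grid_cell k x"]
      by linarith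
    show "AE x in lebesgue_on S. (\<lambda>k. g x - \<phi> k (grid_cell k x)) \<longlonglongrightarrow> 0"
    proof (rule AE_I2)
      fix x
      have 1: "(\<lambda>k. g (grid_corner k (grid_cell k x))) \<longlonglongrightarrow> g x"
        by (rule continuous_on_tendsto_compose[OF g grid_corner_tendsto]) auto
      have "(\<lambda>k. dist (\<phi> k (grid_cell k x)) (g (grid_corner k (grid_cell k x)))) \<longlonglongrightarrow> 0"
      proof (rule tendsto_sandwich[OF _ _ tendsto_const])
        show "(\<lambda>k. 1 / real (Suc k)) \<longlonglongrightarrow> 0" using LIMSEQ_Suc[OF lim_const_over_n[of 1]] by simp
      qed (auto simp: \<phi>_def simp del: of_nat_Suc intro!: always_eventually less_imp_le near(2))
      then have "(\<lambda>k. \<phi> k (grid_cell k x) - g (grid_corner k (grid_cell k x))) \<longlonglongrightarrow> 0"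
        unfolding dist_norm by (simp add: tendsto_norm_zero_iff)
      from tendsto_add[OF this 1] have "(\<lambda>k. \<phi> k (grid_cell k x)) \<longlonglongrightarrow> g x" by simp
      then show "(\<lambda>k. g x - \<phi> k (grid_cell k x)) \<longlonglongrightarrow> 0"
        using tendsto_diff[OF tendsto_const[of "g x"]] by fastforce
    qed
  qed measurable
  from eventually_Lp_norm_less[OF this e3]
  obtain k where k: "Lp_norm \<mu> p (\<lambda>x. g x - \<phi> k (grid_cell k x)) < e / 3" .
  define s where "s L = step_function k (map (\<phi> k) [0..<L])" for L
  have s_eq: "s L x = (if grid_cell k x < L then \<phi> k (grid_cell k x) else 0)" for L x
    by (simp add: s_def step_function_def)
  have sD: "s L \<in> step_functions D" for L
    by (auto simp: s_def step_functions_def \<phi>_def near(1) intro!: image_eqI[where x = "(k, _)"])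
  note sL = step_functions_in_Lp[OF sD]
  have [measurable]: "s L \<in> borel_measurable \<mu>" for L using Lp_functionsD(1)[OF sL] by simp
  have "(\<lambda>L. Lp_norm \<mu> p (\<lambda>x. \<phi> k (grid_cell k x) - s L x)) \<longlonglongrightarrow> 0"
  proof (rule Lp_norm_tendsto_0_bounded[where B = "B + 1"])
    show "norm (\<phi> k (grid_cell k x) - s L x) \<le> B + 1" for L x
      using \<phi>_bound[of k "grid_cell k x"] order_trans[OF norm_ge_zero B[of x]] by (auto simp: s_eq)
    show "AE x in lebesgue_on S. (\<lambda>L. \<phi> k (grid_cell k x) - s L x) \<longlonglongrightarrow> 0"
    proof (rule AE_I2, rule tendsto_eventually)
      fix x
      show "\<forall>\<^sub>F L in sequentially. \<phi> k (grid_cell k x) - s L x = 0"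
        using eventually_gt_at_top[of "grid_cell k x"] by eventually_elim (simp add: s_eq)
    qed
  qed measurable
  from eventually_Lp_norm_less[OF this e3]
  obtain L where L: "Lp_norm \<mu> p (\<lambda>x. \<phi> k (grid_cell k x) - s L x) < e / 3" .
  have gL: "g \<in> Lp_functions \<mu> p" using gm B by (rule bounded_in_Lp)
  have \<phi>L: "(\<lambda>x. \<phi> k (grid_cell k x)) \<in> Lp_functions \<mu> p" using \<phi>m \<phi>_bound by (rule bounded_in_Lp)
  have "Lp_norm \<mu> p (\<lambda>x. u x - s L x) < e"
    using Lp_norm_diff_triangle[OF u gL sL, of L] Lp_norm_diff_triangle[OF gL \<phi>L sL, of L] ug k L by linarith
  then show ?thesis using sD by blast
qed

end

section \<open>Sectors\<close>

text \<open>
  In the polar coordinates \<open>r\<close> and \<open>\<theta>\<close> the two sides differ by \<open>r * sin (\<alpha> - \<bar>\<theta>\<bar>)\<close>. In this form the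
  sector is visibly a closed convex cone.
\<close>

lemma sector_iff:
  assumes "0 < \<alpha>" "\<alpha> \<le> pi / 2"
  shows "z \<in> sector \<alpha> \<longleftrightarrow> \<bar>Im z\<bar> * cos \<alpha> \<le> Re z * sin \<alpha>"
proof -
  have polar: "Re w * sin \<alpha> - \<bar>Im w\<bar> * cos \<alpha> = r * sin (\<alpha> - \<bar>\<theta>\<bar>)"
    if "w = of_real r * cis \<theta>" "0 \<le> r" "\<bar>\<theta>\<bar> \<le> pi" for w r \<theta>
  proof -
    have "\<bar>sin \<theta>\<bar> = sin \<bar>\<theta>\<bar>"
      using that(3) sin_ge_zero[of "\<bar>\<theta>\<bar>"] by (cases "0 \<le> \<theta>") auto
    then show ?thesis
      using that(1,2) by (simp add: sin_diff abs_mult algebra_simps)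
  qed
  show ?thesis
  proof
    assume "z \<in> sector \<alpha>"
    then obtain r \<theta> where z: "z = of_real r * cis \<theta>" "0 \<le> r" "\<bar>\<theta>\<bar> \<le> \<alpha>" by (auto simp: sector_def)
    have "0 \<le> r * sin (\<alpha> - \<bar>\<theta>\<bar>)"
      using z assms by (intro mult_nonneg_nonneg sin_ge_zero) auto
    then show "\<bar>Im z\<bar> * cos \<alpha> \<le> Re z * sin \<alpha>"
      using polar[OF z(1,2)] z(3) assms by linarith
  next
    assume le: "\<bar>Im z\<bar> * cos \<alpha> \<le> Re z * sin \<alpha>"
    show "z \<in> sector \<alpha>"
    proof (cases "z = 0")
      case True
      then show ?thesis using assms by (auto simp: sector_def intro!: exI[of _ 0])
    next
      case False
      have z: "z = of_real (cmod z) * cis (Arg z)"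
        using rcis_cmod_Arg[of z] by (simp add: rcis_def)
      have Arg: "\<bar>Arg z\<bar> \<le> pi" using Arg_bounded[of z] by linarith
      have "0 \<le> cmod z * sin (\<alpha> - \<bar>Arg z\<bar>)"
        using polar[OF z _ Arg] le by simp
      then have "0 \<le> sin (\<alpha> - \<bar>Arg z\<bar>)" using False by (simp add: zero_le_mult_iff)
      then have "\<bar>Arg z\<bar> \<le> \<alpha>"
        using sin_lt_zero[of "\<alpha> - \<bar>Arg z\<bar> + 2 * pi"] Arg assms by (force simp: not_le[symmetric])
      with z show ?thesis unfolding sector_def by fastforce
    qed
  qed
qed

lemma zero_in_sector: "0 \<le> \<alpha> \<Longrightarrow> 0 \<in> sector \<alpha>"
  by (auto simp: sector_def intro!: exI[of _ 0])

lemma closed_sector: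
  assumes "0 < \<alpha>" "\<alpha> \<le> pi / 2"
  shows "closed (sector \<alpha>)"
proof -
  have "sector \<alpha> = {z. \<bar>Im z\<bar> * cos \<alpha> \<le> Re z * sin \<alpha>}" using sector_iff[OF assms] by blast
  also have "closed \<dots>" by (intro closed_Collect_le continuous_intros)
  finally show ?thesis .
qed

lemma sector_add:
  assumes "0 < \<alpha>" "\<alpha> \<le> pi / 2" "z \<in> sector \<alpha>" "w \<in> sector \<alpha>"
  shows "z + w \<in> sector \<alpha>"
proof -
  have "\<bar>Im (z + w)\<bar> * cos \<alpha> \<le> (\<bar>Im z\<bar> + \<bar>Im w\<bar>) * cos \<alpha>"
    using assms cos_ge_zero[of \<alpha>] by (intro mult_right_mono) auto
  then show ?thesis using assms by (simp add: sector_iff distrib_right)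
qed

section \<open>The translation semigroup\<close>

lemma lebesgue_plus:
  fixes t :: "'a::euclidean_space"
  shows "(\<lambda>x. x + t) \<in> lebesgue \<rightarrow>\<^sub>M lebesgue" "distr lebesgue lebesgue (\<lambda>x. x + t) = lebesgue"
proof -
  have eq: "(\<lambda>x. t + (\<Sum>j\<in>Basis. (1 * (x \<bullet> j)) *\<^sub>R j)) = (\<lambda>x. x + t)"
    by (simp add: euclidean_representation add.commute)
  show "(\<lambda>x. x + t) \<in> lebesgue \<rightarrow>\<^sub>M lebesgue"
    using lebesgue_affine_measurable[of "\<lambda>_. 1" t] unfolding eq by simp
  have "lebesgue = density (distr lebesgue lebesgue (\<lambda>x. x + t)) (\<lambda>_. 1)"
    using lebesgue_affine_euclidean[of "\<lambda>_. 1" t] unfolding eq by simp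
  then show "distr lebesgue lebesgue (\<lambda>x. x + t) = lebesgue" by (simp add: density_1)
qed

lemma nn_integral_lebesgue_plus:
  fixes t :: "'a::euclidean_space"
  assumes "f \<in> borel_measurable lebesgue"
  shows "(\<integral>\<^sup>+x. f (x + t) \<partial>lebesgue) = (\<integral>\<^sup>+x. f x \<partial>lebesgue)"
  using nn_integral_distr[OF lebesgue_plus(1), of f t] assms by (simp add: lebesgue_plus(2))

locale admissible_sector =
  fixes \<alpha> :: real and \<rho> :: "complex \<Rightarrow> real" and p M \<omega> :: real
  assumes \<alpha>: "0 < \<alpha>" "\<alpha> \<le> pi / 2"
    and p: "1 \<le> p"
    and measurable_weight: "\<rho> \<in> borel_measurable (lebesgue_on (sector \<alpha>))"
    and integrable_weight: "(\<integral>\<^sup>+ s. ennreal (\<rho> s) \<partial>lebesgue_on (sector \<alpha>)) < \<infinity>"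
    and M: "1 \<le> M"
    and admissible:
      "\<And>t t'. t \<in> sector \<alpha> \<Longrightarrow> t' \<in> sector \<alpha> \<Longrightarrow> \<rho> t \<le> M * exp (\<omega> * norm t') * \<rho> (t + t')"
    and weight_nonneg: "\<And>t. t \<in> sector \<alpha> \<Longrightarrow> 0 \<le> \<rho> t"
begin

abbreviation (input) "S \<equiv> sector \<alpha>"

sublocale integrable_weight "sector \<alpha>" \<rho> p
  using closed_sector[OF \<alpha>] measurable_weight integrable_weight p by unfold_locales auto

definition growth :: "real \<Rightarrow> real" where
  "growth R = M * exp (\<bar>\<omega>\<bar> * R)"

lemma growth_pos: "0 < growth R"
  using M by (simp add: growth_def)

lemma sector_0 [simp]: "0 \<in> S"
  using zero_in_sector \<alpha> by simp

lemma sector_plus [simp]: "t \<in> S \<Longrightarrow> s \<in> S \<Longrightarrow> t + s \<in> S"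
  using sector_add[OF \<alpha>] .

lemma weight_le_growth:
  assumes "x \<in> S" "t \<in> S" "norm t \<le> R"
  shows "\<rho> x \<le> growth R * \<rho> (x + t)"
proof -
  have "\<omega> * norm t \<le> \<bar>\<omega>\<bar> * R" using assms(3) by (intro mult_mono) auto
  then have "M * exp (\<omega> * norm t) * \<rho> (x + t) \<le> growth R * \<rho> (x + t)"
    unfolding growth_def using M weight_nonneg assms by (intro mult_right_mono mult_left_mono) auto
  with admissible[OF assms(1,2)] show ?thesis by linarith
qed

lemma measurable_shift:
  assumes "t \<in> S"
  shows "(\<lambda>x. x + t) \<in> measurable \<mu> \<mu>"
proof -
  have "(\<lambda>x. x + t) \<in> lebesgue_on S \<rightarrow>\<^sub>M lebesgue_on S"
    by (rule measurable_restrict_space2) (use assms lebesgue_plus(1) in \<open>auto intro: measurable_restrict_space1\<close>)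
  then show ?thesis by simp
qed

text \<open>
  By admissibility the density at \<open>x\<close> is bounded by a multiple of the density at \<open>x + t\<close>, and Lebesgue
  measure is invariant. With a power of a norm for \<open>h\<close> this bounds the translations; with the
  indicator of a null set it shows that they respect equality almost everywhere, even if the weight has
  zeros.
\<close>

lemma nn_integral_shift_le:
  assumes [measurable]: "h \<in> borel_measurable \<mu>" and t: "t \<in> S" "norm t \<le> R"
  shows "(\<integral>\<^sup>+x. h (x + t) \<partial>\<mu>) \<le> ennreal (growth R) * (\<integral>\<^sup>+x. h x \<partial>\<mu>)"
proof -
  note S = S_lebesgue
  have h: "h \<in> borel_measurable (lebesgue_on S)" using assms(1) by simp
  have ht: "(\<lambda>x. h (x + t)) \<in> borel_measurable (lebesgue_on S)"
    using measurable_compose[OF measurable_shift[OF t(1)] assms(1)] by simp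
  define g where "g x = (ennreal (\<rho> x) * h x) * indicator S x" for x
  have g: "g \<in> borel_measurable lebesgue"
    unfolding g_def using h S by (intro borel_measurable_restrict_space_iff_ennreal[THEN iffD1]) auto
  have "(\<integral>\<^sup>+x. h (x + t) \<partial>\<mu>) = (\<integral>\<^sup>+x. ennreal (\<rho> x) * h (x + t) \<partial>lebesgue_on S)"
    using ht by (intro nn_integral_density) auto
  also have "\<dots> = (\<integral>\<^sup>+x. ennreal (\<rho> x) * h (x + t) * indicator S x \<partial>lebesgue)"
    using S by (intro nn_integral_restrict_space) auto
  also have "\<dots> \<le> (\<integral>\<^sup>+x. ennreal (growth R) * g (x + t) \<partial>lebesgue)"
  proof (rule nn_integral_mono)
    fix x
    show "ennreal (\<rho> x) * h (x + t) * indicator S x \<le> ennreal (growth R) * g (x + t)"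
    proof (cases "x \<in> S")
      case True
      have "ennreal (\<rho> x) \<le> ennreal (growth R) * ennreal (\<rho> (x + t))"
        using weight_le_growth[OF True t] weight_nonneg[of "x + t"] growth_pos[of R] True t
        by (simp add: ennreal_mult[symmetric] ennreal_leI)
      from mult_right_mono[OF this, of "h (x + t)"] show ?thesis
        using True t by (simp add: g_def mult.assoc)
    qed simp
  qed
  also have "\<dots> = ennreal (growth R) * (\<integral>\<^sup>+x. g (x + t) \<partial>lebesgue)"
    using measurable_compose[OF lebesgue_plus(1) g] by (intro nn_integral_cmult)
  also have "(\<integral>\<^sup>+x. g (x + t) \<partial>lebesgue) = (\<integral>\<^sup>+x. g x \<partial>lebesgue)"
    by (rule nn_integral_lebesgue_plus[OF g])
  also have "\<dots> = (\<integral>\<^sup>+x. ennreal (\<rho> x) * h x \<partial>lebesgue_on S)"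
    unfolding g_def using S by (intro nn_integral_restrict_space[symmetric]) auto
  also have "\<dots> = (\<integral>\<^sup>+x. h x \<partial>\<mu>)"
    using h by (intro nn_integral_density[symmetric]) auto
  finally show ?thesis .
qed

lemma AE_shift:
  assumes "AE x in \<mu>. P x" "t \<in> S"
  shows "AE x in \<mu>. P (x + t)"
proof -
  from assms(1) obtain N where N: "{x \<in> space \<mu>. \<not> P x} \<subseteq> N" "emeasure \<mu> N = 0" "N \<in> sets \<mu>"
    by (rule AE_E)
  have "(\<integral>\<^sup>+x. indicator N (x + t) \<partial>\<mu>) \<le> ennreal (growth (norm t)) * (\<integral>\<^sup>+x. indicator N x \<partial>\<mu>)"
    by (rule nn_integral_shift_le) (use N assms(2) in auto)
  also have "(\<integral>\<^sup>+x. indicator N x \<partial>\<mu>) = 0" using N by simp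
  finally have "(\<integral>\<^sup>+x. (indicator N (x + t) :: ennreal) \<partial>\<mu>) = 0" by simp
  moreover have "(\<lambda>x. indicator N (x + t) :: ennreal) \<in> borel_measurable \<mu>"
    by (rule measurable_compose[OF measurable_shift[OF assms(2)]]) (use N in auto)
  ultimately have "AE x in \<mu>. (indicator N (x + t) :: ennreal) = 0"
    by (subst (asm) nn_integral_0_iff_AE) auto
  moreover have "AE x in \<mu>. x \<in> S" by (rule AE_I2) simp
  ultimately show ?thesis
  proof eventually_elim
    case (elim x)
    then have "x + t \<in> space \<mu>" "x + t \<notin> N" using assms(2) by (auto simp: indicator_def split: if_splits)
    then show ?case using N(1) by blast
  qed
qed

lemma Lp_shift:
  fixes u :: "complex \<Rightarrow> 'k::{real_normed_field,euclidean_space}"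
  assumes u: "u \<in> Lp_functions \<mu> p" and t: "t \<in> S" "norm t \<le> R"
  shows "(\<lambda>x. u (x + t)) \<in> Lp_functions \<mu> p"
    "Lp_norm \<mu> p (\<lambda>x. u (x + t)) \<le> growth R powr (1 / p) * Lp_norm \<mu> p u"
proof -
  have m: "(\<lambda>x. u (x + t)) \<in> borel_measurable \<mu>"
    using measurable_compose[OF measurable_shift[OF t(1)] Lp_functionsD(1)[OF u]] .
  have [measurable]: "u \<in> borel_measurable \<mu>" using Lp_functionsD(1)[OF u] .
  have "(\<integral>\<^sup>+x. ennreal (norm (u (x + t)) powr p) \<partial>\<mu>)
      \<le> ennreal (growth R) * (\<integral>\<^sup>+x. ennreal (norm (u x) powr p) \<partial>\<mu>)"
    by (rule nn_integral_shift_le[OF _ t, of "\<lambda>x. ennreal (norm (u x) powr p)"]) measurable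
  also have "\<dots> = ennreal ((growth R powr (1 / p) * Lp_norm \<mu> p u) powr p)"
    unfolding nn_integral_Lp_norm[OF u] using growth_pos[of R] p_pos
    by (simp add: powr_mult powr_powr ennreal_mult less_imp_le)
  finally have le: "(\<integral>\<^sup>+x. ennreal (norm (u (x + t)) powr p) \<partial>\<mu>)
      \<le> ennreal ((growth R powr (1 / p) * Lp_norm \<mu> p u) powr p)" .
  have nonneg: "0 \<le> growth R powr (1 / p) * Lp_norm \<mu> p u"
    by (intro mult_nonneg_nonneg Lp_norm_nonneg) auto
  show "(\<lambda>x. u (x + t)) \<in> Lp_functions \<mu> p"
    "Lp_norm \<mu> p (\<lambda>x. u (x + t)) \<le> growth R powr (1 / p) * Lp_norm \<mu> p u"
    using Lp_norm_leI[OF m nonneg le] by auto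
qed

lemma translation_Lp_class:
  fixes u :: "complex \<Rightarrow> 'k::{real_normed_field,euclidean_space}"
  assumes u: "u \<in> Lp_functions \<mu> p" and t: "t \<in> S"
  shows "translation \<alpha> \<rho> p t (Lp_class \<mu> p u) = Lp_class \<mu> p (\<lambda>x. u (x + t))"
proof -
  have eq: "Lp_class \<mu> p (\<lambda>x. f (x + t)) = Lp_class \<mu> p (\<lambda>x. u (x + t))" if "f \<in> Lp_class \<mu> p u" for f
    using that t Lp_shift(1)[OF _ t order_refl] AE_shift[of "\<lambda>x. f x = u x" t]
    by (intro Lp_class_eqI) (auto simp: in_Lp_class_iff eq_commute)
  have "translation \<alpha> \<rho> p t (Lp_class \<mu> p u) = (\<Union>f\<in>Lp_class \<mu> p u. Lp_class \<mu> p (\<lambda>x. f (x + t)))"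
    by (simp add: translation_def weighted_measure_def Lp_class_def)
  also have "\<dots> = Lp_class \<mu> p (\<lambda>x. u (x + t))"
    by (intro UN_constant_eq[OF Lp_class_self[OF u]] ballI eq)
  finally show ?thesis .
qed

text \<open>
  For a bounded continuous function the translates converge pointwise and boundedly, hence in the mean
  because the measure is finite. The operators are uniformly bounded near a point of the sector, so the
  general case follows by approximation.
\<close>

lemma translation_continuous:
  fixes u :: "complex \<Rightarrow> 'k::{real_normed_field,euclidean_space}"
  assumes u: "u \<in> Lp_functions \<mu> p" and t: "t \<in> S"
  shows "((\<lambda>s. Lp_norm \<mu> p (\<lambda>x. u (x + s) - u (x + t))) \<longlongrightarrow> 0) (at t within S)"
  unfolding tendsto_at_iff_sequentially
proof (intro allI impI)
  fix X :: "nat \<Rightarrow> complex"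
  assume X: "\<forall>i. X i \<in> S - {t}" and lim: "X \<longlonglongrightarrow> t"
  define R where "R = norm t + 1"
  define C where "C = growth R powr (1 / p)"
  have C: "0 < C" using growth_pos[of R] by (simp add: C_def)
  have XS: "X i \<in> S" for i using X by blast
  have "(\<lambda>n. Lp_norm \<mu> p (\<lambda>x. u (x + X n) - u (x + t))) \<longlonglongrightarrow> 0"
  proof (rule LIMSEQ_I)
    fix e :: real assume e: "0 < e"
    then have "0 < e / (4 * C)" using C by simp
    from bounded_continuous_dense[OF u this] obtain g B where g: "continuous_on UNIV g"
      and B: "\<And>x. norm (g x) \<le> B" and ug: "Lp_norm \<mu> p (\<lambda>x. u x - g x) < e / (4 * C)" by blast
    have gL: "g \<in> Lp_functions \<mu> p"
      by (intro bounded_in_Lp[OF _ B] borel_imp_measurable_mu borel_measurable_continuous_onI g)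
    have near: "Lp_norm \<mu> p (\<lambda>x. u (x + s) - g (x + s)) < e / 4" if "s \<in> S" "norm s \<le> R" for s
    proof -
      have "Lp_norm \<mu> p (\<lambda>x. u (x + s) - g (x + s)) \<le> C * Lp_norm \<mu> p (\<lambda>x. u x - g x)"
        unfolding C_def using Lp_shift(2)[OF Lp_diff[OF u gL] that] .
      also have "\<dots> < C * (e / (4 * C))" using ug C by (intro mult_strict_left_mono)
      finally show ?thesis using C by simp
    qed
    have "(\<lambda>n. Lp_norm \<mu> p (\<lambda>x. g (x + X n) - g (x + t))) \<longlonglongrightarrow> 0"
    proof (rule Lp_norm_tendsto_0_bounded[where B = "B + B"])
      show "(\<lambda>x. g (x + X n) - g (x + t)) \<in> borel_measurable \<mu>" for n
        by (intro borel_measurable_diff Lp_functionsD(1) Lp_shift(1)[OF gL _ order_refl] XS t)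
      show "norm (g (x + X n) - g (x + t)) \<le> B + B" for n x
        using norm_triangle_ineq4[of "g (x + X n)" "g (x + t)"] B[of "x + X n"] B[of "x + t"] by linarith
      have "(\<lambda>n. g (x + X n) - g (x + t)) \<longlonglongrightarrow> g (x + t) - g (x + t)" for x
        by (intro tendsto_diff tendsto_const continuous_on_tendsto_compose[OF g] tendsto_add lim) auto
      then show "AE x in lebesgue_on S. (\<lambda>n. g (x + X n) - g (x + t)) \<longlonglongrightarrow> 0" by simp
    qed
    then have "\<forall>\<^sub>F n in sequentially. Lp_norm \<mu> p (\<lambda>x. g (x + X n) - g (x + t)) < e / 4"
      using e by (intro order_tendstoD) auto
    moreover have "\<forall>\<^sub>F n in sequentially. norm (X n) < R"
      by (intro order_tendstoD(2)[OF tendsto_norm[OF lim]]) (simp add: R_def)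
    ultimately have "\<forall>\<^sub>F n in sequentially. Lp_norm \<mu> p (\<lambda>x. u (x + X n) - u (x + t)) < e"
    proof eventually_elim
      case (elim n)
      note L = Lp_shift(1)[OF u XS order_refl, of n] Lp_shift(1)[OF gL XS order_refl, of n]
        Lp_shift(1)[OF gL t order_refl] Lp_shift(1)[OF u t order_refl]
      have "Lp_norm \<mu> p (\<lambda>x. u (x + X n) - u (x + t)) \<le>
          Lp_norm \<mu> p (\<lambda>x. u (x + X n) - g (x + X n)) + (Lp_norm \<mu> p (\<lambda>x. g (x + X n) - g (x + t))
            + Lp_norm \<mu> p (\<lambda>x. g (x + t) - u (x + t)))"
        using Lp_norm_diff_triangle[OF L(1,2,4)] Lp_norm_diff_triangle[OF L(2,3,4)] by linarith
      moreover have "Lp_norm \<mu> p (\<lambda>x. g (x + t) - u (x + t)) < e / 4"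
        using near[OF t] Lp_norm_diff_commute[of "\<lambda>x. g (x + t)" "\<lambda>x. u (x + t)"] by (simp add: R_def)
      ultimately show ?case using near[OF XS, of n] elim e by linarith
    qed
    then show "\<exists>N. \<forall>n\<ge>N. norm (Lp_norm \<mu> p (\<lambda>x. u (x + X n) - u (x + t)) - 0) < e"
      by (simp add: eventually_sequentially Lp_norm_nonneg)
  qed
  then show "((\<lambda>s. Lp_norm \<mu> p (\<lambda>x. u (x + s) - u (x + t))) \<circ> X) \<longlonglongrightarrow> 0"
    by (simp add: comp_def)
qed

theorem C0_semigroup_translation:
  "C0_semigroup \<alpha> (Lp_space \<mu> p :: ('k::{real_normed_field,euclidean_space}, _) normed_module)
     (translation \<alpha> \<rho> p)"
proof (rule C0_semigroup.intro[OF banach_vector_space_Lp_space], unfold_locales)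
  fix t assume t: "t \<in> S"
  show "bounded_operator (Lp_space \<mu> p :: ('k, _) normed_module) (translation \<alpha> \<rho> p t)"
    unfolding bounded_operator_def carrier_Lp_space
  proof (intro conjI ballI allI)
    show "translation \<alpha> \<rho> p t \<in> Lp_class \<mu> p ` (Lp_functions \<mu> p :: (complex \<Rightarrow> 'k) set) \<rightarrow> Lp_class \<mu> p ` Lp_functions \<mu> p"
      using t Lp_shift(1)[OF _ t order_refl] by (auto simp: translation_Lp_class intro!: imageI)
    show "\<exists>C. \<forall>x\<in>Lp_class \<mu> p ` (Lp_functions \<mu> p :: (complex \<Rightarrow> 'k) set).
        vnorm (Lp_space \<mu> p) (translation \<alpha> \<rho> p t x) \<le> C * vnorm (Lp_space \<mu> p) x"
    proof (intro exI ballI)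
      fix x assume "x \<in> Lp_class \<mu> p ` (Lp_functions \<mu> p :: (complex \<Rightarrow> 'k) set)"
      then obtain u where u: "u \<in> Lp_functions \<mu> p" "x = Lp_class \<mu> p u" by blast
      show "vnorm (Lp_space \<mu> p) (translation \<alpha> \<rho> p t x)
          \<le> growth (norm t) powr (1 / p) * vnorm (Lp_space \<mu> p) x"
        using Lp_shift[OF u(1) t order_refl] u t by (simp add: translation_Lp_class Lp_space_vnorm)
    qed
  next
    fix x y assume "x \<in> Lp_class \<mu> p ` (Lp_functions \<mu> p :: (complex \<Rightarrow> 'k) set)"
      "y \<in> Lp_class \<mu> p ` (Lp_functions \<mu> p :: (complex \<Rightarrow> 'k) set)"
    then obtain u v where "u \<in> Lp_functions \<mu> p" "x = Lp_class \<mu> p u"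
      "v \<in> Lp_functions \<mu> p" "y = Lp_class \<mu> p v" by blast
    then show "translation \<alpha> \<rho> p t (x \<oplus>\<^bsub>Lp_space \<mu> p\<^esub> y)
        = translation \<alpha> \<rho> p t x \<oplus>\<^bsub>Lp_space \<mu> p\<^esub> translation \<alpha> \<rho> p t y"
      using t Lp_shift(1)[of u t "norm t"] Lp_shift(1)[of v t "norm t"]
      by (simp add: translation_Lp_class Lp_space_add Lp_add)
  next
    fix a and x assume "x \<in> Lp_class \<mu> p ` (Lp_functions \<mu> p :: (complex \<Rightarrow> 'k) set)"
    then obtain u where "u \<in> Lp_functions \<mu> p" "x = Lp_class \<mu> p u" by blast
    then show "translation \<alpha> \<rho> p t (a \<odot>\<^bsub>Lp_space \<mu> p\<^esub> x) = a \<odot>\<^bsub>Lp_space \<mu> p\<^esub> translation \<alpha> \<rho> p t x"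
      using t Lp_shift(1)[of u t "norm t"] by (simp add: translation_Lp_class Lp_space_smult Lp_scale)
  qed
next
  fix x :: "(complex \<Rightarrow> 'k) set" assume "x \<in> carrier (Lp_space \<mu> p)"
  then obtain u where u: "u \<in> Lp_functions \<mu> p" "x = Lp_class \<mu> p u" by (auto simp: carrier_Lp_space)
  show "translation \<alpha> \<rho> p 0 x = x" using u by (simp add: translation_Lp_class)
  fix t assume t: "t \<in> S"
  show "limitin (vtopology (Lp_space \<mu> p)) (\<lambda>s. translation \<alpha> \<rho> p s x) (translation \<alpha> \<rho> p t x) (at t within S)"
  proof (rule limitin_transform_eventually)
    show "\<forall>\<^sub>F s in at t within S. Lp_class \<mu> p (\<lambda>x. u (x + s)) = translation \<alpha> \<rho> p s x"
      unfolding eventually_at_filter by (intro always_eventually) (simp add: u translation_Lp_class)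
    have "\<forall>\<^sub>F s in at t within S. (\<lambda>x. u (x + s)) \<in> Lp_functions \<mu> p"
      unfolding eventually_at_filter by (intro always_eventually) (auto intro: Lp_shift(1)[OF u(1) _ order_refl])
    then show "limitin (vtopology (Lp_space \<mu> p)) (\<lambda>s. Lp_class \<mu> p (\<lambda>x. u (x + s)))
        (translation \<alpha> \<rho> p t x) (at t within S)"
      unfolding u(2) translation_Lp_class[OF u(1) t]
      by (intro limitin_Lp_space translation_continuous u t Lp_shift(1)[OF u(1) t order_refl])
  qed
  fix s assume s: "s \<in> S"
  show "translation \<alpha> \<rho> p (t + s) x = translation \<alpha> \<rho> p t (translation \<alpha> \<rho> p s x)"
    using u t s Lp_shift(1)[OF u(1) s order_refl] by (simp add: translation_Lp_class add.assoc)
qed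

end

section \<open>The Frequent Hypercyclicity Criterion\<close>

lemma finite_measure_tail:
  fixes \<nu> :: "'a::real_normed_vector measure"
  assumes "finite_measure \<nu>" and sets: "\<And>r. {x \<in> space \<nu>. r \<le> norm x} \<in> sets \<nu>" and e: "0 < e"
  obtains r where "0 < r" "measure \<nu> {x \<in> space \<nu>. r \<le> norm x} < e"
proof -
  interpret finite_measure \<nu> by fact
  let ?A = "\<lambda>n::nat. {x \<in> space \<nu>. real n \<le> norm x}"
  have "(\<lambda>n. measure \<nu> (?A n)) \<longlonglongrightarrow> measure \<nu> (\<Inter>n. ?A n)"
    by (rule finite_Lim_measure_decseq) (use sets in \<open>auto simp: decseq_def\<close>)
  also have "(\<Inter>n. ?A n) = {}"
  proof (rule equals0I)
    fix x assume "x \<in> (\<Inter>n. ?A n)"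
    then have "real n \<le> norm x" for n by simp
    then show False using reals_Archimedean2[of "norm x"] by (meson not_le)
  qed
  finally have "(\<lambda>n. measure \<nu> (?A n)) \<longlonglongrightarrow> 0" by simp
  then have "\<forall>\<^sub>F n in sequentially. measure \<nu> (?A n) < e \<and> 0 < n"
    using e by (intro eventually_conj order_tendstoD eventually_gt_at_top)
  then obtain n where "measure \<nu> (?A n) < e" "0 < n" by (auto simp: eventually_sequentially)
  then show thesis by (intro that[of "real n"]) auto
qed

text \<open>Points at mutual distance at least 1 have different integer parts.\<close>

lemma card_separated_le:
  fixes \<gamma> :: "'a \<Rightarrow> real"
  assumes J: "finite J" and sep: "\<And>n k. n \<in> J \<Longrightarrow> k \<in> J \<Longrightarrow> n \<noteq> k \<Longrightarrow> 1 \<le> \<bar>\<gamma> n - \<gamma> k\<bar>"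
    and R: "0 \<le> R"
  shows "real (card {n \<in> J. \<bar>\<gamma> n - c\<bar> \<le> R}) \<le> 2 * R + 2"
proof -
  let ?J = "{n \<in> J. \<bar>\<gamma> n - c\<bar> \<le> R}"
  have "inj_on (\<lambda>n. \<lfloor>\<gamma> n\<rfloor>) ?J"
  proof (rule inj_onI, rule ccontr)
    fix n k assume "n \<in> ?J" "k \<in> ?J" "\<lfloor>\<gamma> n\<rfloor> = \<lfloor>\<gamma> k\<rfloor>" "n \<noteq> k"
    then show False using sep[of n k] by auto linarith
  qed
  then have "card ?J = card ((\<lambda>n. \<lfloor>\<gamma> n\<rfloor>) ` ?J)" by (simp add: card_image)
  also have "\<dots> \<le> card {\<lfloor>c - R\<rfloor>..\<lfloor>c + R\<rfloor>}"
    by (rule card_mono) (auto intro!: floor_mono)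
  also have "\<dots> = nat (\<lfloor>c + R\<rfloor> - \<lfloor>c - R\<rfloor> + 1)" by simp
  finally have "real (card ?J) \<le> real (nat (\<lfloor>c + R\<rfloor> - \<lfloor>c - R\<rfloor> + 1))" by simp
  also have "\<dots> \<le> 2 * R + 2" using R by linarith
  finally show ?thesis .
qed

context integrable_weight
begin

abbreviation tail :: "real \<Rightarrow> real" where
  "tail r \<equiv> measure \<mu> {x \<in> S. r \<le> norm x}"

lemma sets_far [measurable]: "{x \<in> S. r \<le> norm x} \<in> sets \<mu>"
proof -
  have [measurable]: "norm \<in> borel_measurable \<mu>" by (rule borel_imp_measurable_mu) simp
  have "{x \<in> space \<mu>. r \<le> norm x} \<in> sets \<mu>" by measurable
  then show ?thesis by simp
qed

lemma tail_small:
  assumes "0 < e"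
  obtains r where "0 < r" "tail r < e"
  by (rule finite_measure_tail[OF finite_measure_axioms _ assms]) (use sets_far that in simp_all)

lemma Lp_norm_le_tail:
  fixes u :: "complex \<Rightarrow> 'k::{real_normed_field,euclidean_space}"
  assumes u: "u \<in> borel_measurable \<mu>" and C: "0 \<le> C" "\<And>x. x \<in> S \<Longrightarrow> norm (u x) \<le> C"
    and far: "\<And>x. x \<in> S \<Longrightarrow> u x \<noteq> 0 \<Longrightarrow> r \<le> norm x"
  shows "Lp_norm \<mu> p u \<le> C * tail r powr (1 / p)"
proof (rule Lp_norm_leI(2)[OF u])
  show "0 \<le> C * tail r powr (1 / p)" using C by simp
  have "(\<integral>\<^sup>+x. ennreal (norm (u x) powr p) \<partial>\<mu>)
      \<le> (\<integral>\<^sup>+x. ennreal (C powr p) * indicator {x \<in> S. r \<le> norm x} x \<partial>\<mu>)"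
  proof (rule nn_integral_mono)
    fix x assume "x \<in> space \<mu>"
    then have x: "x \<in> S" by simp
    show "ennreal (norm (u x) powr p) \<le> ennreal (C powr p) * indicator {x \<in> S. r \<le> norm x} x"
      using far[OF x] x C(2)[OF x] p_pos
      by (cases "u x = 0") (auto intro!: ennreal_leI powr_mono2)
  qed
  also have "\<dots> = ennreal (C powr p) * emeasure \<mu> {x \<in> S. r \<le> norm x}"
    by (rule nn_integral_cmult_indicator[OF sets_far])
  also have "\<dots> = ennreal ((C * tail r powr (1 / p)) powr p)"
  proof -
    have "(C * tail r powr (1 / p)) powr p = C powr p * tail r"
      using C p_pos by (simp add: powr_mult powr_powr)
    then show ?thesis unfolding emeasure_eq_measure by (simp only: ennreal_mult' powr_ge_zero)
  qed
  finally show "(\<integral>\<^sup>+x. ennreal (norm (u x) powr p) \<partial>\<mu>) \<le> ennreal ((C * tail r powr (1 / p)) powr p)" .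
qed

end

context admissible_sector
begin

definition right_shift :: "complex \<Rightarrow> (complex \<Rightarrow> 'k::zero) \<Rightarrow> complex \<Rightarrow> 'k" where
  "right_shift t g x = (if x - t \<in> S then g (x - t) else 0)"

lemma borel_measurable_right_shift:
  fixes g :: "complex \<Rightarrow> 'k::{real_normed_field,euclidean_space}"
  assumes [measurable]: "g \<in> borel_measurable borel"
  shows "right_shift t g \<in> borel_measurable borel"
proof -
  have [measurable]: "S \<in> sets borel" by (rule borel_closed[OF closed_sector[OF \<alpha>]])
  show ?thesis unfolding right_shift_def[abs_def] by measurable
qed

text \<open>
  Translating a function supported in a ball of radius \<open>R\<close> forwards by \<open>m n\<close> and backwards by \<open>l n\<close>
  moves its support into the annulus of radius \<open>\<gamma> n\<close> and width \<open>2 * R\<close>. Since the radii are separated, at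
  most \<open>2 * R + 2\<close> of the annuli meet in a point, so the sum stays bounded independently of \<open>J\<close> while its
  support moves away from the origin.
\<close>

lemma shifted_sum_small:
  fixes g :: "complex \<Rightarrow> 'k::{real_normed_field,euclidean_space}"
  assumes g: "g \<in> borel_measurable borel" and B: "\<And>x. norm (g x) \<le> B"
    and R: "0 \<le> R" "\<And>x. g x \<noteq> 0 \<Longrightarrow> norm x \<le> R"
    and J: "finite J" and lm: "\<And>n. n \<in> J \<Longrightarrow> l n \<in> S" "\<And>n. n \<in> J \<Longrightarrow> m n \<in> S"
    and \<gamma>: "\<And>n. n \<in> J \<Longrightarrow> \<gamma> n = cmod (l n - m n)" "\<And>n. n \<in> J \<Longrightarrow> r + R \<le> \<gamma> n"
    and sep: "\<And>n k. n \<in> J \<Longrightarrow> k \<in> J \<Longrightarrow> n \<noteq> k \<Longrightarrow> 1 \<le> \<bar>\<gamma> n - \<gamma> k\<bar>"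
  shows "Lp_norm \<mu> p (\<lambda>x. \<Sum>n\<in>J. right_shift (m n) g (x + l n)) \<le> (2 * R + 2) * B * tail r powr (1 / p)"
proof (rule Lp_norm_le_tail)
  have B0: "0 \<le> B" using order_trans[OF norm_ge_zero B[of 0]] .
  then show "0 \<le> (2 * R + 2) * B" using R by simp
  have "(\<lambda>x. right_shift (m n) g (x + l n)) \<in> borel_measurable \<mu>" for n
    by (rule borel_imp_measurable_mu, rule measurable_compose[OF _ borel_measurable_right_shift[OF g]]) measurable
  then show "(\<lambda>x. \<Sum>n\<in>J. right_shift (m n) g (x + l n)) \<in> borel_measurable \<mu>"
    by (intro borel_measurable_sum)
  have near: "\<bar>\<gamma> n - norm x\<bar> \<le> R" if "n \<in> J" "right_shift (m n) g (x + l n) \<noteq> 0" for n x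
  proof -
    have "norm (x + l n - m n) \<le> R" using that R(2) by (auto simp: right_shift_def split: if_splits)
    moreover have "\<bar>norm (l n - m n) - norm (- x)\<bar> \<le> norm (l n - m n - (- x))" by (rule norm_triangle_ineq3)
    ultimately show ?thesis using \<gamma>(1)[OF that(1)] by (simp add: algebra_simps)
  qed
  fix x :: complex
  let ?J = "{n \<in> J. \<bar>\<gamma> n - norm x\<bar> \<le> R}"
  have "(\<Sum>n\<in>J. right_shift (m n) g (x + l n)) = (\<Sum>n\<in>?J. right_shift (m n) g (x + l n))"
    by (rule sum.mono_neutral_right[OF J]) (use near in auto)
  also have "norm \<dots> \<le> real (card ?J) * B"
    by (rule sum_norm_bound) (use B B0 in \<open>auto simp: right_shift_def\<close>)
  also have "\<dots> \<le> (2 * R + 2) * B"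
    by (rule mult_right_mono[OF card_separated_le[OF J sep R(1)] B0])
  finally show "norm (\<Sum>n\<in>J. right_shift (m n) g (x + l n)) \<le> (2 * R + 2) * B" .
  assume "(\<Sum>n\<in>J. right_shift (m n) g (x + l n)) \<noteq> 0"
  then obtain n where "n \<in> J" "right_shift (m n) g (x + l n) \<noteq> 0" by (meson sum.neutral)
  then show "r \<le> norm x" using near[of n x] \<gamma>(2)[of n] by linarith
qed

text \<open>
  The inverse shifts act on a chosen step function in each class: where the weight vanishes, a shift to the
  right may turn functions that agree almost everywhere into functions that do not.
\<close>

theorem criterion_translation:
  "frequent_hypercyclicity_criterion \<alpha>
     (Lp_space \<mu> p :: ('k::{real_normed_field,euclidean_space}, _) normed_module) (translation \<alpha> \<rho> p)"
proof -
  let ?X = "Lp_space \<mu> p :: ('k, _) normed_module" and ?T = "translation \<alpha> \<rho> p"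
  obtain D :: "'k set" where D: "countable D" "\<And>V. open V \<Longrightarrow> V \<noteq> {} \<Longrightarrow> \<exists>d\<in>D. d \<in> V"
    using countable_dense_exists by blast
  define G where "G = step_functions D"
  define X\<^sub>0 where "X\<^sub>0 = Lp_class \<mu> p ` G"
  have GL: "g \<in> Lp_functions \<mu> p" if "g \<in> G" for g
    using step_functions_in_Lp that unfolding G_def .
  have GB: "g \<in> borel_measurable borel" if "g \<in> G" for g
    using that by (auto simp: G_def step_functions_def)
  define rep where "rep c = (SOME g. g \<in> G \<and> c = Lp_class \<mu> p g)" for c
  have rep: "rep c \<in> G" "Lp_class \<mu> p (rep c) = c" if "c \<in> X\<^sub>0" for c
    using someI_ex[of "\<lambda>g. g \<in> G \<and> c = Lp_class \<mu> p g"] that unfolding rep_def X\<^sub>0_def by auto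
  define Sh where "Sh t c = Lp_class \<mu> p (right_shift t (rep c))" for t c
  have shL: "right_shift t g \<in> Lp_functions \<mu> p" if g: "g \<in> G" for t g
  proof -
    obtain k l where "g = step_function k l" using g by (auto simp: G_def step_functions_def)
    then obtain B where "0 < B" "\<And>x. norm (g x) \<le> B" using step_function_bounded[of k l] by metis
    then show ?thesis
      by (intro bounded_in_Lp[where B = B] borel_imp_measurable_mu borel_measurable_right_shift GB[OF g])
         (auto simp: right_shift_def less_imp_le)
  qed
  have TSh: "?T l (Sh m c) = Lp_class \<mu> p (\<lambda>x. right_shift m (rep c) (x + l))" if "l \<in> S" "c \<in> X\<^sub>0" for l m c
    unfolding Sh_def by (rule translation_Lp_class[OF shL[OF rep(1)] that(1)]) fact
  have X\<^sub>0_carrier: "X\<^sub>0 \<subseteq> carrier ?X"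
    unfolding X\<^sub>0_def using GL Lp_class_in_carrier by blast
  have dense: "vtopology ?X closure_of X\<^sub>0 = carrier ?X"
    unfolding X\<^sub>0_def using step_functions_dense[OF D(2)] GL
    by (intro closure_Lp_space_eq_carrierI) (auto simp: G_def)
  have top: "topspace (vtopology ?X) = carrier ?X"
    unfolding vtopology_def by (rule Metric_space.topspace_mtopology[OF Metric_space_Lp_space])
  have "separable_space (vtopology ?X)"
    unfolding separable_space_def top
    by (rule exI[of _ X\<^sub>0])
       (use dense X\<^sub>0_carrier countable_step_functions[OF D(1)] in \<open>simp add: X\<^sub>0_def G_def\<close>)
  moreover have "\<exists>r>0. Sup {ereal (vnorm ?X (\<Oplus>\<^bsub>?X\<^esub>n\<in>J. ?T (l n) (Sh (m n) c))) |(J :: nat set) l m \<gamma>.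
                     finite J \<and>
                     (\<forall>n\<in>J. l n \<in> S \<and> m n \<in> S \<and> \<gamma> n = cmod (l n - m n)) \<and>
                     (\<forall>n\<in>J. r \<le> \<bar>\<gamma> n\<bar>) \<and>
                     (\<forall>n\<in>J. \<forall>k\<in>J. n \<noteq> k \<longrightarrow> 1 \<le> \<bar>\<gamma> n - \<gamma> k\<bar>)}
              < ereal \<epsilon>"
    if c: "c \<in> X\<^sub>0" and \<epsilon>: "0 < \<epsilon>" for c \<epsilon>
  proof -
    obtain k vs where g: "rep c = step_function k vs" using rep(1)[OF c] by (auto simp: G_def step_functions_def)
    obtain B R where BR: "0 < B" "0 < R" "\<And>x. norm (rep c x) \<le> B" "\<And>x. rep c x \<noteq> 0 \<Longrightarrow> norm x \<le> R"
      unfolding g by (rule step_function_bounded[of k vs]) blast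
    define C where "C = (2 * R + 2) * B"
    have C: "0 < C" using BR by (simp add: C_def)
    then have "0 < (\<epsilon> / (2 * C)) powr p" using \<epsilon> by simp
    from tail_small[OF this] obtain r where r: "0 < r" "tail r < (\<epsilon> / (2 * C)) powr p" .
    have "tail r powr (1 / p) \<le> ((\<epsilon> / (2 * C)) powr p) powr (1 / p)"
      using r p_pos by (intro powr_mono2) auto
    then have "C * tail r powr (1 / p) \<le> C * (\<epsilon> / (2 * C))"
      using C \<epsilon> p_pos by (intro mult_left_mono) (auto simp: powr_powr)
    then have small: "C * tail r powr (1 / p) \<le> \<epsilon> / 2" using C by simp
    have "vnorm ?X (\<Oplus>\<^bsub>?X\<^esub>n\<in>J. ?T (l n) (Sh (m n) c)) \<le> \<epsilon> / 2"
      if J: "finite J" and lm: "\<forall>n\<in>J. l n \<in> S \<and> m n \<in> S \<and> \<gamma> n = cmod (l n - m n)"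
        and \<gamma>: "\<forall>n\<in>J. r + R \<le> \<bar>\<gamma> n\<bar>" and sep: "\<forall>n\<in>J. \<forall>k\<in>J. n \<noteq> k \<longrightarrow> 1 \<le> \<bar>\<gamma> n - \<gamma> k\<bar>"
      for J :: "nat set" and l m \<gamma>
    proof -
      have L: "(\<lambda>x. right_shift (m n) (rep c) (x + l n)) \<in> Lp_functions \<mu> p" if "n \<in> J" for n
        using lm that by (intro Lp_shift(1)[OF shL[OF rep(1)[OF c]] _ order_refl]) auto
      have "(\<Oplus>\<^bsub>?X\<^esub>n\<in>J. ?T (l n) (Sh (m n) c))
          = (\<Oplus>\<^bsub>?X\<^esub>n\<in>J. Lp_class \<mu> p (\<lambda>x. right_shift (m n) (rep c) (x + l n)))"
        using lm c L abelian_group.axioms(1)[OF abelian_group_Lp_space]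
        by (intro abelian_monoid.finsum_cong') (auto simp: TSh Lp_class_in_carrier)
      also have "\<dots> = Lp_class \<mu> p (\<lambda>x. \<Sum>n\<in>J. right_shift (m n) (rep c) (x + l n))"
        by (rule Lp_space_finsum[OF J L])
      finally have "vnorm ?X (\<Oplus>\<^bsub>?X\<^esub>n\<in>J. ?T (l n) (Sh (m n) c))
          = Lp_norm \<mu> p (\<lambda>x. \<Sum>n\<in>J. right_shift (m n) (rep c) (x + l n))"
        by (simp add: Lp_space_vnorm Lp_sum L)
      also have "\<dots> \<le> (2 * R + 2) * B * tail r powr (1 / p)"
        by (rule shifted_sum_small[where \<gamma> = \<gamma>])
           (use GB[OF rep(1)[OF c]] BR J lm \<gamma> sep in \<open>auto simp: less_imp_le\<close>)
      finally show ?thesis using small by (simp add: C_def)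
    qed
    then show ?thesis
      using r BR(2) \<epsilon> by (intro exI[of _ "r + R"] conjI le_less_trans[OF Sup_least[where z = "ereal (\<epsilon> / 2)"]]) auto
  qed
  moreover have "limitin (vtopology ?X) (\<lambda>t. ?T t (Sh t c)) c (inf at_infinity (principal S))"
    if c: "c \<in> X\<^sub>0" for c
  proof (rule limitin_eventually)
    show "c \<in> topspace (vtopology ?X)" using c X\<^sub>0_carrier top by blast
    have "?T t (Sh t c) = c" if t: "t \<in> S" for t
    proof -
      have "Lp_class \<mu> p (\<lambda>x. right_shift t (rep c) (x + t)) = Lp_class \<mu> p (rep c)"
        by (rule Lp_class_eqI[OF Lp_shift(1)[OF shL[OF rep(1)[OF c]] t order_refl] GL[OF rep(1)[OF c]]], rule AE_I2)
           (simp add: right_shift_def)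
      then show ?thesis using TSh[OF t c] rep(2)[OF c] by simp
    qed
    then show "\<forall>\<^sub>F t in inf at_infinity (principal S). ?T t (Sh t c) = c"
      by (auto simp: eventually_inf_principal)
  qed
  moreover have "\<forall>t\<in>S. Sh t \<in> X\<^sub>0 \<rightarrow> carrier ?X"
    unfolding Sh_def by (intro ballI Pi_I Lp_class_in_carrier shL rep(1))
  ultimately show ?thesis
    unfolding frequent_hypercyclicity_criterion_def
    using C0_semigroup_translation X\<^sub>0_carrier dense
    by (intro conjI exI[of _ X\<^sub>0] exI[of _ Sh]) auto
qed

end

section \<open>A pattern of points of positive lower density\<close>

text \<open>
  The strip of the points whose real part lies between \<open>2 ^ m + 2 ^ k\<close> and \<open>2 ^ m + 2 ^ Suc k\<close>, where
  \<open>m = k + j + 1\<close>, is reserved for the index \<open>j\<close>. In it the square lattice of mesh \<open>N j\<close> is used, up to a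
  margin of \<open>N j\<close> at both sides. The width of the strip is a fixed proportion of the scale \<open>2 ^ m\<close>, which
  gives positive density, whereas points belonging to different strips are kept apart by both margins.
  The bound \<open>\<kappa> * 2 ^ m\<close> on the imaginary part puts the points into a sector.
\<close>

definition lattice_points :: "real \<Rightarrow> (nat \<Rightarrow> nat) \<Rightarrow> nat \<Rightarrow> complex set" where
  "lattice_points \<kappa> N j =
     {Complex (2 ^ (k + j + 1) + 2 ^ k + real (N j) * real a) (real (N j) * real b) |k a b.
        1 \<le> a \<and> real (N j) * (real a + 1) \<le> 2 ^ k \<and> real (N j) * real b \<le> \<kappa> * 2 ^ (k + j + 1)}"

lemma countable_lattice_points: "countable (lattice_points \<kappa> N j)"
proof -
  have "lattice_points \<kappa> N j \<subseteq> range (\<lambda>(k, a, b).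
      Complex (2 ^ (k + j + 1) + 2 ^ k + real (N j) * real a) (real (N j) * real b))"
  proof
    fix n assume "n \<in> lattice_points \<kappa> N j"
    then obtain k a b where
      "n = Complex (2 ^ (k + j + 1) + 2 ^ k + real (N j) * real a) (real (N j) * real b)"
      by (auto simp: lattice_points_def)
    then show "n \<in> range (\<lambda>(k, a, b).
        Complex (2 ^ (k + j + 1) + 2 ^ k + real (N j) * real a) (real (N j) * real b))"
      by (intro range_eqI[of _ _ "(k, a, b)"]) simp
  qed
  then show ?thesis by (rule countable_subset) simp
qed

lemma lattice_points_ge_mesh:
  assumes "n \<in> lattice_points \<kappa> N j"
  shows "real (N j) \<le> norm n"
proof -
  from assms obtain k a b where n: "n = Complex (2 ^ (k + j + 1) + 2 ^ k + real (N j) * real a) (real (N j) * real b)"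
    and a: "1 \<le> a" by (auto simp: lattice_points_def)
  have "real (N j) * 1 \<le> real (N j) * real a" using a by (intro mult_left_mono) auto
  then have "real (N j) \<le> Re n" unfolding n by (simp add: add_increasing)
  then show ?thesis using complex_Re_le_cmod[of n] by linarith
qed

lemma lattice_points_separated:
  assumes n: "n \<in> lattice_points \<kappa> N i" and n': "n' \<in> lattice_points \<kappa> N j" and neq: "(i, n) \<noteq> (j, n')"
  shows "real (max (N i) (N j)) \<le> norm (n - n')"
proof -
  \<comment> \<open>Strips are ordered lexicographically by \<open>(m, k)\<close>, and each ends before the next one begins.\<close>
  have strips: "real (N i + N j) \<le> norm (n - n')"
    if n: "Re n + N i \<le> 2 ^ (k + i + 1) + 2 ^ Suc k" and n': "2 ^ (k' + j + 1) + 2 ^ k' + N j \<le> Re n'"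
      and less: "k + i + 1 < k' + j + 1 \<or> k + i + 1 = k' + j + 1 \<and> k < k'"
    for i j k k' :: nat and n n' :: complex
  proof -
    have "(2::real) ^ (k + i + 1) + 2 ^ Suc k \<le> 2 ^ (k' + j + 1) + 2 ^ k'"
    proof (cases "k + i + 1 < k' + j + 1")
      case True
      have "(2::real) ^ Suc k \<le> 2 ^ (k + i + 1)" by (intro power_increasing) auto
      moreover have "(2::real) ^ Suc (k + i + 1) \<le> 2 ^ (k' + j + 1)" using True by (intro power_increasing) auto
      moreover have "(0::real) \<le> 2 ^ k'" by simp
      ultimately show ?thesis unfolding power_Suc[of _ "k + i + 1"] by linarith
    next
      case False
      then have "k + i + 1 = k' + j + 1" "Suc k \<le> k'" using less by auto
      then show ?thesis using power_increasing[of "Suc k" k' "2::real"] by simp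
    qed
    then have "real (N i + N j) \<le> Re (n' - n)" using n n' by simp
    then show ?thesis using complex_Re_le_cmod[of "n' - n"] by (simp add: norm_minus_commute)
  qed
  have ge: "2 ^ (k + j + 1) + 2 ^ k + real (N j) \<le> 2 ^ (k + j + 1) + 2 ^ k + real (N j) * real a"
    if "1 \<le> a" for k j a
    using mult_left_mono[of 1 "real a" "real (N j)"] that by simp
  from n obtain k a b where n: "n = Complex (2 ^ (k + i + 1) + 2 ^ k + real (N i) * real a) (real (N i) * real b)"
    and a: "1 \<le> a" "real (N i) * (real a + 1) \<le> 2 ^ k" by (auto simp: lattice_points_def)
  from n' obtain k' a' b' where n': "n' = Complex (2 ^ (k' + j + 1) + 2 ^ k' + real (N j) * real a') (real (N j) * real b')"
    and a': "1 \<le> a'" "real (N j) * (real a' + 1) \<le> 2 ^ k'" by (auto simp: lattice_points_def)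
  have up: "Re n + N i \<le> 2 ^ (k + i + 1) + 2 ^ Suc k" "Re n' + N j \<le> 2 ^ (k' + j + 1) + 2 ^ Suc k'"
    using a(2) a'(2) by (simp_all add: n n' distrib_left)
  have lo: "2 ^ (k + i + 1) + 2 ^ k + N i \<le> Re n" "2 ^ (k' + j + 1) + 2 ^ k' + N j \<le> Re n'"
    using ge[OF a(1), of k i] ge[OF a'(1), of k' j] by (simp_all add: n n')
  consider "k + i + 1 < k' + j + 1 \<or> k + i + 1 = k' + j + 1 \<and> k < k'"
    | "k' + j + 1 < k + i + 1 \<or> k' + j + 1 = k + i + 1 \<and> k' < k" | "i = j" "k = k'" by linarith
  then show ?thesis
  proof cases
    case 1
    then show ?thesis using strips[OF up(1) lo(2)] by (simp add: max_def split: if_splits)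
  next
    case 2
    then show ?thesis using strips[OF up(2) lo(1)] by (simp add: norm_minus_commute max_def split: if_splits)
  next
    case 3
    have far: "real (N j) \<le> \<bar>real (N j) * real c - real (N j) * real d\<bar>" if "c \<noteq> d" for c d :: nat
    proof -
      have "1 \<le> \<bar>real c - real d\<bar>" using that by linarith
      then have "real (N j) * 1 \<le> real (N j) * \<bar>real c - real d\<bar>" by (intro mult_left_mono) auto
      also have "\<dots> = \<bar>real (N j) * real c - real (N j) * real d\<bar>"
        by (simp add: right_diff_distrib[symmetric] abs_mult)
      finally show ?thesis by simp
    qed
    have "a \<noteq> a' \<or> b \<noteq> b'" using neq 3 n n' by auto
    then have "real (N j) \<le> \<bar>Re (n - n')\<bar> \<or> real (N j) \<le> \<bar>Im (n - n')\<bar>"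
      using far[of a a'] far[of b b'] 3 by (auto simp: n n')
    then show ?thesis
      using abs_Re_le_cmod[of "n - n'"] abs_Im_le_cmod[of "n - n'"] 3 by auto
  qed
qed

lemma lattice_points_in_sector:
  assumes "0 < \<alpha>" "\<alpha> \<le> pi / 2" "n \<in> lattice_points (sin \<alpha>) N j"
  shows "n \<in> sector \<alpha>"
proof -
  from assms(3) obtain k a b where n: "n = Complex (2 ^ (k + j + 1) + 2 ^ k + real (N j) * real a) (real (N j) * real b)"
    and b: "real (N j) * real b \<le> sin \<alpha> * 2 ^ (k + j + 1)" by (auto simp: lattice_points_def)
  have "\<bar>Im n\<bar> * cos \<alpha> \<le> \<bar>Im n\<bar> * 1" by (intro mult_left_mono) auto
  also have "\<dots> \<le> sin \<alpha> * 2 ^ (k + j + 1)" using b by (simp add: n)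
  also have "\<dots> \<le> sin \<alpha> * Re n"
    using assms sin_ge_zero[of \<alpha>] by (intro mult_left_mono) (auto simp: n add_increasing2)
  finally show ?thesis using assms by (simp add: sector_iff mult.commute)
qed

lemma card_lattice_points_ge:
  assumes N: "0 < N j" and \<kappa>: "0 < \<kappa>" "\<kappa> \<le> 1" and k: "4 * real (N j) \<le> 2 ^ k"
  obtains F where "finite F" "F \<subseteq> lattice_points \<kappa> N j" "\<And>n. n \<in> F \<Longrightarrow> norm n \<le> 3 * 2 ^ (k + j + 1)"
    "\<kappa> * 2 ^ k * 2 ^ (k + j + 1) / (2 * (real (N j))\<^sup>2) \<le> real (card F)"
proof -
  define c where "c = real (N j)"
  define m where "m = k + j + 1"
  have c: "0 < c" "4 * c \<le> 2 ^ k" using N k by (auto simp: c_def)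
  define A where "A = nat (\<lfloor>2 ^ k / c\<rfloor> - 1)"
  define B where "B = nat \<lfloor>\<kappa> * 2 ^ m / c\<rfloor>"
  define pt where "pt ab = (case ab of (a, b) \<Rightarrow> Complex (2 ^ m + 2 ^ k + c * real a) (c * real b))" for ab :: "nat \<times> nat"
  let ?F = "pt ` ({1..A} \<times> {..B})"
  have q: "4 \<le> 2 ^ k / c" using c by (simp add: field_simps)
  have "4 \<le> \<lfloor>2 ^ k / c\<rfloor>" using q by (simp add: le_floor_iff)
  then have "real A = of_int \<lfloor>2 ^ k / c\<rfloor> - 1" unfolding A_def by simp
  note real_A = this
  have half: "y / 2 \<le> of_int \<lfloor>y\<rfloor> - 1" if "4 \<le> y" for y :: real using that by linarith
  have A: "2 ^ k / c / 2 \<le> real A" using half[OF q] real_A by simp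
  have A': "real A + 1 \<le> 2 ^ k / c" using real_A by linarith
  have B0: "0 \<le> \<kappa> * 2 ^ m / c" using \<kappa> c by simp
  have "real B = of_int \<lfloor>\<kappa> * 2 ^ m / c\<rfloor>" unfolding B_def using B0 by simp
  note real_B = this
  have B: "\<kappa> * 2 ^ m / c \<le> real B + 1" using real_B by linarith
  have B': "real B \<le> \<kappa> * 2 ^ m / c" using real_B by linarith
  have a: "c * (real a + 1) \<le> 2 ^ k" if "a \<le> A" for a
  proof -
    have "c * (real a + 1) \<le> c * (2 ^ k / c)" using A' that c by (intro mult_left_mono) auto
    then show ?thesis using c by simp
  qed
  have b: "c * real b \<le> \<kappa> * 2 ^ m" if "b \<le> B" for b
  proof -
    have "c * real b \<le> c * (\<kappa> * 2 ^ m / c)" using B' that c by (intro mult_left_mono) auto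
    then show ?thesis using c by simp
  qed
  show thesis
  proof (rule that[of ?F])
    show "finite ?F" by simp
    show "?F \<subseteq> lattice_points \<kappa> N j"
    proof
      fix n assume "n \<in> ?F"
      then obtain x y where xy: "1 \<le> x" "x \<le> A" "y \<le> B" "n = Complex (2 ^ m + 2 ^ k + c * real x) (c * real y)"
        by (auto simp: pt_def)
      then show "n \<in> lattice_points \<kappa> N j"
        using a[of x] b[of y] unfolding lattice_points_def c_def m_def by blast
    qed
    fix n assume "n \<in> ?F"
    then obtain x y where xy: "x \<le> A" "y \<le> B" "n = Complex (2 ^ m + 2 ^ k + c * real x) (c * real y)"
      by (auto simp: pt_def)
    have "norm n \<le> \<bar>Re n\<bar> + \<bar>Im n\<bar>" by (rule cmod_le)
    also have "\<dots> = 2 ^ m + 2 ^ k + c * real x + c * real y" using c by (simp add: xy abs_of_nonneg)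
    also have "\<dots> \<le> 2 ^ m + 2 ^ k + 2 ^ k + 2 ^ m"
    proof -
      have "\<kappa> * 2 ^ m \<le> 1 * 2 ^ m" using \<kappa> by (intro mult_right_mono) auto
      then have "c * real y \<le> 2 ^ m" using b[OF xy(2)] by linarith
      moreover have "c * real x \<le> 2 ^ k" using a[OF xy(1)] c(1) by (simp add: distrib_left)
      ultimately show ?thesis by linarith
    qed
    also have "\<dots> \<le> 3 * 2 ^ m"
    proof -
      have "(2::real) ^ Suc k \<le> 2 ^ m" by (intro power_increasing) (auto simp: m_def)
      then show ?thesis by simp
    qed
    finally show "norm n \<le> 3 * 2 ^ (k + j + 1)" unfolding m_def .
  next
    have "inj_on pt ({1..A} \<times> {..B})" using c by (auto simp: inj_on_def pt_def)
    then have card: "card ?F = A * (B + 1)" by (simp add: card_image)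
    have "\<kappa> * 2 ^ k * 2 ^ (k + j + 1) / (2 * (real (N j))\<^sup>2) = (2 ^ k / c / 2) * (\<kappa> * 2 ^ m / c)"
      by (simp add: c_def m_def power2_eq_square)
    also have "\<dots> \<le> real A * (real B + 1)"
      using A B B0 q by (intro mult_mono) auto
    finally show "\<kappa> * 2 ^ k * 2 ^ (k + j + 1) / (2 * (real (N j))\<^sup>2) \<le> real (card ?F)"
      unfolding card by (simp add: algebra_simps)
  qed
qed

text \<open>
  In the disc of radius \<open>t\<close> there are of the order of \<open>t\<^sup>2\<close> lattice points of the index \<open>j\<close>, namely those in
  the strip at the scale \<open>2 ^ m\<close> comparable to \<open>t\<close>, and the translates of \<open>sector \<alpha> \<inter> ball 0 \<delta>\<close> to
  these are disjoint.
\<close>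

lemma lower_density_pos:
  assumes \<alpha>: "0 < \<alpha>" "\<alpha> \<le> pi / 2"
    and E: "E \<in> sets lebesgue" and N: "0 < N j" and \<delta>: "0 < \<delta>" "\<delta> \<le> 1 / 2"
    and sub: "\<And>n s. n \<in> lattice_points (sin \<alpha>) N j \<Longrightarrow> s \<in> sector \<alpha> \<Longrightarrow> norm s < \<delta> \<Longrightarrow> n + s \<in> E"
  shows "0 < lower_density \<alpha> E"
proof -
  define W where "W = sector \<alpha> \<inter> ball 0 \<delta>"
  define v where "v = measure lebesgue W"
  have sin: "0 < sin \<alpha>" using \<alpha> pi_gt_zero by (intro sin_gt_zero) linarith+
  have S: "sector \<alpha> \<in> sets lebesgue" using closed_sector[OF \<alpha>] by auto
  have W: "W \<in> lmeasurable"
    unfolding W_def Int_commute[of "sector \<alpha>"] using S by (intro fmeasurable_Int_fmeasurable) auto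
  have v: "0 < v"
  proof -
    let ?O = "{z. \<bar>Im z\<bar> * cos \<alpha> < Re z * sin \<alpha>} \<inter> ball 0 \<delta>"
    have O: "open ?O" by (intro open_Int open_Collect_less continuous_intros) auto
    have "complex_of_real (\<delta> / 2) \<in> ?O" using \<delta> sin by simp
    then have nO: "\<not> negligible ?O" by (intro open_not_negligible[OF O]) (metis empty_iff)
    have OW: "?O \<subseteq> W" by (auto simp: W_def sector_iff[OF \<alpha>])
    have "\<not> negligible W" using negligible_subset[OF _ OW] nO by meson
    then have "measure lebesgue W \<noteq> 0" using W by (simp add: negligible_iff_measure)
    then show ?thesis by (simp add: v_def zero_less_measure_iff)
  qed
  define \<Delta> where "\<Delta> t = {s \<in> sector \<alpha>. norm s \<le> t}" for t
  have \<Delta>: "\<Delta> t \<in> lmeasurable" for t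
  proof -
    have "\<Delta> t = cball 0 t \<inter> sector \<alpha>" by (auto simp: \<Delta>_def)
    then show ?thesis using S by (auto intro: fmeasurable_Int_fmeasurable)
  qed
  define \<beta> where "\<beta> = unit_ball_vol 2"
  have \<beta>: "0 < \<beta>" by (simp add: \<beta>_def)
  have upper: "measure lebesgue (\<Delta> t) \<le> \<beta> * t\<^sup>2" if "0 \<le> t" for t
  proof -
    have "measure lebesgue (\<Delta> t) \<le> measure lebesgue (cball (0::complex) t)"
      by (rule measure_mono_fmeasurable) (use \<Delta>[of t] in \<open>auto simp: \<Delta>_def\<close>)
    also have "\<dots> = \<beta> * t\<^sup>2" using content_cball[OF that, of "0::complex"] by (simp add: \<beta>_def)
    finally show ?thesis .
  qed
  define q where "q = sin \<alpha> / (4 * 2 ^ j * (real (N j))\<^sup>2)"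
  have q: "0 < q" using sin N by (simp add: q_def)
  have lower: "q * v * (2 ^ m)\<^sup>2 \<le> measure lebesgue (E \<inter> \<Delta> t)"
    if m: "m = k + j + 1" and k: "4 * real (N j) \<le> 2 ^ k" and t: "4 * 2 ^ m \<le> t" for m k t
  proof -
    from card_lattice_points_ge[where N = N and j = j, OF N sin sin_le_one k] obtain F where F: "finite F"
      "F \<subseteq> lattice_points (sin \<alpha>) N j" "\<And>n. n \<in> F \<Longrightarrow> norm n \<le> 3 * 2 ^ (k + j + 1)"
      and card: "sin \<alpha> * 2 ^ k * 2 ^ (k + j + 1) / (2 * (real (N j))\<^sup>2) \<le> real (card F)" by blast
    have "q * (2 ^ m)\<^sup>2 = sin \<alpha> * 2 ^ k * 2 ^ (k + j + 1) / (2 * (real (N j))\<^sup>2)"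
      using N unfolding q_def m by (simp add: power_add power2_eq_square)
    with card have "q * v * (2 ^ m)\<^sup>2 \<le> real (card F) * v"
      using v mult_right_mono[of "q * (2 ^ m)\<^sup>2" "real (card F)" v] by (simp add: ac_simps)
    also have "\<dots> = (\<Sum>n\<in>F. measure lebesgue ((+) n ` W))"
      by (simp add: v_def measure_translation)
    also have "\<dots> = measure lebesgue (\<Union>n\<in>F. (+) n ` W)"
    proof (rule measure_finite_Union[symmetric, OF F(1)])
      show "(\<lambda>n. (+) n ` W) ` F \<subseteq> sets lebesgue"
        using measurable_translation[OF W] by auto
      show "emeasure lebesgue ((+) n ` W) \<noteq> \<infinity>" if "n \<in> F" for n
        using measurable_translation[OF W, of n] by (auto simp: fmeasurable_def)
      show "disjoint_family_on (\<lambda>n. (+) n ` W) F"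
        unfolding disjoint_family_on_def
      proof (intro ballI impI equals0I)
        fix n n' z assume nn: "n \<in> F" "n' \<in> F" "n \<noteq> n'" and "z \<in> (+) n ` W \<inter> (+) n' ` W"
        then obtain s s' where s: "n + s = n' + s'" "norm s < \<delta>" "norm s' < \<delta>" by (auto simp: W_def)
        then have "n - n' = s' - s" by (simp add: algebra_simps)
        then have "norm (n - n') < 1" using s \<delta> norm_triangle_ineq4[of s' s] by simp
        moreover have "real (N j) \<le> norm (n - n')"
          using lattice_points_separated[of n "sin \<alpha>" N j n' j] F(2) nn by auto
        ultimately show False using N by linarith
      qed
    qed
    also have "\<dots> \<le> measure lebesgue (E \<inter> \<Delta> t)"
    proof (rule measure_mono_fmeasurable)
      show "(\<Union>n\<in>F. (+) n ` W) \<in> sets lebesgue"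
        using F(1) measurable_translation[OF W] by (intro sets.finite_UN) auto
      show "E \<inter> \<Delta> t \<in> lmeasurable" unfolding Int_commute[of E] by (rule fmeasurable_Int_fmeasurable[OF \<Delta> E])
      show "(\<Union>n\<in>F. (+) n ` W) \<subseteq> E \<inter> \<Delta> t"
      proof (clarify, intro IntI)
        fix n s assume n: "n \<in> F" and s: "s \<in> W"
        then have nj: "n \<in> lattice_points (sin \<alpha>) N j" using F(2) by blast
        show "n + s \<in> E" using sub[OF nj, of s] s by (simp add: W_def)
        have "norm (n + s) \<le> 3 * 2 ^ m + 1"
          using norm_triangle_ineq[of n s] F(3)[OF n] s \<delta> unfolding m by (simp add: W_def)
        also have "\<dots> \<le> t"
        proof -
          have "(1::real) \<le> 2 ^ m" by simp
          then show ?thesis using t by linarith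
        qed
        finally show "n + s \<in> \<Delta> t"
          using sector_add[OF \<alpha> lattice_points_in_sector[OF \<alpha> nj]] s by (auto simp: \<Delta>_def W_def)
      qed
    qed
    finally show ?thesis .
  qed
  define \<epsilon> where "\<epsilon> = q * v / (64 * \<beta>)"
  have \<epsilon>: "0 < \<epsilon>" using q v \<beta> by (simp add: \<epsilon>_def)
  obtain k\<^sub>0 where k\<^sub>0: "4 * real (N j) \<le> 2 ^ k\<^sub>0"
    using real_arch_pow[of 2 "4 * real (N j)"] by (auto intro: less_imp_le)
  define m\<^sub>0 where "m\<^sub>0 = k\<^sub>0 + j + 1"
  have "\<epsilon> \<le> measure lebesgue (E \<inter> \<Delta> t) / measure lebesgue (\<Delta> t)" if t: "4 * 2 ^ m\<^sub>0 \<le> t" for t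
  proof -
    have t4: "2 ^ m\<^sub>0 \<le> nat \<lfloor>t / 4\<rfloor>"
      using t by (simp add: le_nat_iff le_floor_iff)
    moreover have "(1::nat) \<le> 2 ^ m\<^sub>0" by simp
    ultimately have "1 \<le> nat \<lfloor>t / 4\<rfloor>" by linarith
    from ex_power_ivl1[OF _ this, of 2] obtain m where m: "2 ^ m \<le> nat \<lfloor>t / 4\<rfloor>" "nat \<lfloor>t / 4\<rfloor> < 2 ^ (m + 1)" by auto
    have "(2::nat) ^ m\<^sub>0 < 2 ^ (m + 1)" using t4 m(2) by linarith
    then have "m\<^sub>0 < m + 1" by (rule power_less_imp_less_exp[rotated]) simp
    then obtain k where k: "m = k + j + 1" "k\<^sub>0 \<le> k"
      by (intro that[of "m - j - 1"]) (auto simp: m\<^sub>0_def)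
    have k2: "4 * real (N j) \<le> 2 ^ k"
      using k\<^sub>0 power_increasing[OF k(2), of "2::real"] by linarith
    have t_nonneg: "0 \<le> t / 4" using t zero_less_power[of "2::real" m\<^sub>0] by linarith
    have "real (2 ^ m) \<le> real (nat \<lfloor>t / 4\<rfloor>)" using m(1) by (rule of_nat_mono)
    also have "\<dots> \<le> t / 4" by (rule of_nat_floor[OF t_nonneg])
    finally have t1: "4 * 2 ^ m \<le> t" by simp
    have "nat \<lfloor>t / 4\<rfloor> + 1 \<le> 2 ^ (m + 1)" using m(2) by linarith
    then have "real (nat \<lfloor>t / 4\<rfloor> + 1) \<le> real (2 ^ (m + 1))" by (rule of_nat_mono)
    moreover have "t / 4 \<le> real (nat \<lfloor>t / 4\<rfloor> + 1)" using t_nonneg by linarith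
    ultimately have "t / 4 \<le> 2 * 2 ^ m" by simp
    then have t2: "t \<le> 8 * 2 ^ m" by simp
    have t0: "0 < t" using t1 zero_less_power[of "2::real" m] by linarith
    have low: "q * v * (2 ^ m)\<^sup>2 \<le> measure lebesgue (E \<inter> \<Delta> t)" by (rule lower[OF k(1) k2 t1])
    have "0 < q * v * (2 ^ m)\<^sup>2" using q v by simp
    also note low
    also have "measure lebesgue (E \<inter> \<Delta> t) \<le> measure lebesgue (\<Delta> t)"
      using E \<Delta>[of t] by (intro measure_mono_fmeasurable) auto
    finally have pos: "0 < measure lebesgue (\<Delta> t)" .
    have "t\<^sup>2 \<le> (8 * 2 ^ m)\<^sup>2" using t2 t0 by (intro power_mono) auto
    then have "\<epsilon> * (\<beta> * t\<^sup>2) \<le> \<epsilon> * (\<beta> * (64 * (2 ^ m)\<^sup>2))"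
      using \<epsilon> \<beta> by (simp add: power_mult_distrib)
    also have "\<dots> = q * v * (2 ^ m)\<^sup>2" using \<beta> by (simp add: \<epsilon>_def)
    finally have "\<epsilon> * (\<beta> * t\<^sup>2) \<le> measure lebesgue (E \<inter> \<Delta> t)" using low by linarith
    moreover have "\<epsilon> * measure lebesgue (\<Delta> t) \<le> \<epsilon> * (\<beta> * t\<^sup>2)"
      using upper[of t] t0 \<epsilon> by (intro mult_left_mono) auto
    ultimately show ?thesis using pos by (simp add: le_divide_eq)
  qed
  then have "\<forall>\<^sub>F t in at_top. ereal \<epsilon> \<le> ereal (measure lebesgue (E \<inter> \<Delta> t) / measure lebesgue (\<Delta> t))"
    unfolding eventually_at_top_linorder by auto
  then have "ereal \<epsilon> \<le> lower_density \<alpha> E"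
    unfolding lower_density_def \<Delta>_def by (rule Liminf_bounded)
  then show ?thesis using \<epsilon> by (metis ereal_less(2) less_le_trans)
qed

section \<open>A frequently hypercyclic function\<close>

text \<open>
  A copy of the function \<open>g j\<close>, whose bound is \<open>B j\<close> and whose support has radius \<open>R j\<close>, is placed at
  every lattice point of the index \<open>j\<close>. The function \<open>\<Phi>\<close> records how large \<open>N j\<close> has to be in relation
  to \<open>B j\<close>: copies of the index \<open>j\<close> are seen at a distance of at least \<open>N j / 2\<close> only, both from
  the origin and from any other lattice point, so that \<open>\<Phi>\<close> dominates all that is seen of them.
\<close>

locale lattice_pattern = admissible_sector \<alpha> \<rho> p M \<omega>
  for \<alpha> \<rho> p M \<omega> +
  fixes g :: "nat \<Rightarrow> complex \<Rightarrow> 'k::{real_normed_field,euclidean_space}"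
    and B R :: "nat \<Rightarrow> real" and N :: "nat \<Rightarrow> nat" and \<Phi> :: "complex \<Rightarrow> ennreal"
  assumes g_borel [measurable]: "\<And>j. g j \<in> borel_measurable borel"
    and g_bound: "\<And>j x. norm (g j x) \<le> B j"
    and g_support: "\<And>j x. g j x \<noteq> 0 \<Longrightarrow> norm x \<le> R j"
    and mesh: "\<And>j. 2 * R j < real (N j)" "\<And>j. j < N j"
    and \<Phi>_borel [measurable]: "\<Phi> \<in> borel_measurable borel"
    and \<Phi>_integrable: "(\<integral>\<^sup>+x. \<Phi> x \<partial>\<mu>) < \<infinity>"
    and \<Phi>_ge: "\<And>j x. real (N j) / 2 \<le> norm x \<Longrightarrow> ennreal (B j powr p) \<le> \<Phi> x"
begin

abbreviation A :: "nat \<Rightarrow> complex set" where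
  "A \<equiv> lattice_points (sin \<alpha>) N"

text \<open>
  At most one pair is active at a point, because the meshes exceed the diameters of the supports; so the
  sum has at most one term.
\<close>

definition active :: "complex \<Rightarrow> (nat \<times> complex) set" where
  "active x = {(j, n). n \<in> A j \<and> x - n \<in> S \<and> g j (x - n) \<noteq> 0}"

definition pattern :: "complex \<Rightarrow> 'k" where
  "pattern x = (\<Sum>(j, n)\<in>active x. g j (x - n))"

lemma active_unique:
  assumes "(i, m) \<in> active x" "(j, n) \<in> active x"
  shows "(i, m) = (j, n)"
proof (rule ccontr)
  assume neq: "(i, m) \<noteq> (j, n)"
  have "real (max (N i) (N j)) \<le> norm (m - n)"
    using assms neq by (intro lattice_points_separated) (auto simp: active_def)
  moreover have "norm (m - n) \<le> norm (x - n) + norm (x - m)"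
    using norm_triangle_ineq4[of "x - n" "x - m"] by simp
  moreover have "norm (x - m) \<le> R i" "norm (x - n) \<le> R j"
    using assms g_support by (auto simp: active_def)
  ultimately show False using mesh(1)[of i] mesh(1)[of j] by (auto simp: max_def split: if_splits)
qed

lemma pattern_active: "(j, n) \<in> active x \<Longrightarrow> pattern x = g j (x - n)"
proof -
  assume "(j, n) \<in> active x"
  then have "active x = {(j, n)}" using active_unique by fastforce
  then show ?thesis by (simp add: pattern_def)
qed

lemma pattern_nonzeroE:
  assumes "pattern x \<noteq> 0"
  obtains j n where "(j, n) \<in> active x"
proof -
  have "active x \<noteq> {}" using assms by (auto simp: pattern_def)
  then show thesis using that by auto
qed

lemma borel_measurable_pattern: "pattern \<in> borel_measurable borel"
proof -
  have [measurable]: "S \<in> sets borel" by (rule borel_closed[OF closed_sector[OF \<alpha>]])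
  define K where "K = (SIGMA j:UNIV. A j)"
  define P where "P jn = (case jn of (j, n) \<Rightarrow> {x. x - n \<in> S \<and> g j (x - n) \<noteq> 0})" for jn
  have K: "countable K" unfolding K_def by (intro countable_SIGMA countable_lattice_points) auto
  have P: "P jn \<in> sets borel" for jn
  proof -
    obtain j n where "jn = (j, n)" by force
    moreover have "{x \<in> space borel. x - n \<in> S \<and> g j (x - n) \<noteq> 0} \<in> sets borel" by measurable
    ultimately show ?thesis by (simp add: P_def)
  qed
  define Z where "Z = - (\<Union>jn\<in>K. P jn)"
  have Z: "Z \<in> sets borel" unfolding Z_def using K P by (intro borel_comp sets.countable_UN') auto
  have active_iff: "(j, n) \<in> active x \<longleftrightarrow> (j, n) \<in> K \<and> x \<in> P (j, n)" for j n x
    by (auto simp: active_def K_def P_def)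
  show ?thesis
  proof (rule measurable_piecewise_restrict)
    show "countable (insert Z (P ` K))" using K by simp
    show "\<Omega> \<inter> space borel \<in> sets borel" if "\<Omega> \<in> insert Z (P ` K)" for \<Omega> using that P Z by auto
    show "space borel \<subseteq> \<Union> (insert Z (P ` K))" by (auto simp: Z_def)
    fix \<Omega> assume "\<Omega> \<in> insert Z (P ` K)"
    then consider "\<Omega> = Z" | jn where "jn \<in> K" "\<Omega> = P jn" by blast
    then show "pattern \<in> borel_measurable (restrict_space borel \<Omega>)"
    proof cases
      case 1
      have "pattern x = 0" if "x \<in> Z" for x
      proof (rule ccontr)
        assume "pattern x \<noteq> 0"
        then obtain j n where "(j, n) \<in> active x" by (rule pattern_nonzeroE)
        then have "(j, n) \<in> K" "x \<in> P (j, n)" using active_iff[of j n x] by simp_all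
        then show False using that unfolding Z_def by blast
      qed
      then have "pattern \<in> borel_measurable (restrict_space borel \<Omega>) \<longleftrightarrow>
          (\<lambda>_. 0 :: 'k) \<in> borel_measurable (restrict_space borel \<Omega>)"
        using 1 by (intro measurable_cong) (simp add: space_restrict_space)
      then show ?thesis by simp
    next
      case 2
      obtain j n where jn: "jn = (j, n)" by force
      have "pattern x = g j (x - n)" if "x \<in> P jn" for x
        using that 2(1) unfolding jn by (intro pattern_active) (simp add: active_iff)
      then have "pattern \<in> borel_measurable (restrict_space borel \<Omega>) \<longleftrightarrow>
          (\<lambda>x. g j (x - n)) \<in> borel_measurable (restrict_space borel \<Omega>)"
        using 2 by (intro measurable_cong) (simp add: space_restrict_space)
      moreover have "(\<lambda>x. g j (x - n)) \<in> borel_measurable borel" by measurable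
      ultimately show ?thesis by (simp add: measurable_restrict_space1)
    qed
  qed
qed

lemma norm_powr_le_\<Phi>:
  assumes "norm y \<le> B i" "real (N i) / 2 \<le> norm x"
  shows "ennreal (norm y powr p) \<le> \<Phi> x"
  by (rule order_trans[OF ennreal_leI[OF powr_mono2] \<Phi>_ge[OF assms(2)]]) (use assms p_pos in auto)

lemma pattern_le_\<Phi>: "ennreal (norm (pattern x) powr p) \<le> \<Phi> x"
proof (cases "pattern x = 0")
  case False
  then obtain j n where jn: "(j, n) \<in> active x" by (rule pattern_nonzeroE)
  then have "real (N j) \<le> norm n" "norm (x - n) \<le> R j"
    using lattice_points_ge_mesh g_support by (auto simp: active_def)
  then have "real (N j) / 2 \<le> norm x"
    using mesh(1)[of j] norm_triangle_ineq4[of x "x - n"] by simp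
  then show ?thesis
    unfolding pattern_active[OF jn] by (rule norm_powr_le_\<Phi>[OF g_bound])
qed simp

lemma pattern_in_Lp: "pattern \<in> Lp_functions \<mu> p"
proof -
  have "(\<integral>\<^sup>+x. ennreal (norm (pattern x) powr p) \<partial>\<mu>) \<le> (\<integral>\<^sup>+x. \<Phi> x \<partial>\<mu>)"
    by (intro nn_integral_mono pattern_le_\<Phi>)
  then have fin: "(\<integral>\<^sup>+x. ennreal (norm (pattern x) powr p) \<partial>\<mu>) < \<infinity>"
    using \<Phi>_integrable by (rule le_less_trans)
  have [measurable]: "pattern \<in> borel_measurable \<mu>"
    by (rule borel_imp_measurable_mu[OF borel_measurable_pattern])
  have "integrable \<mu> (\<lambda>x. norm (pattern x) powr p)"
    by (rule integrableI_bounded) (use fin in auto)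
  then show ?thesis by (simp add: Lp_functions_def)
qed

text \<open>
  The copy at \<open>n\<close> itself produces \<open>g j\<close>. A difference is thus due to a copy at another lattice
  point \<open>m\<close> of some index \<open>i\<close>, whose distance from \<open>n\<close> is at least \<open>N i\<close> and at least \<open>N j\<close>.
\<close>

lemma pattern_near_lattice_point:
  assumes n: "n \<in> A j" and x: "x \<in> S" and neq: "pattern (x + n) \<noteq> g j x"
  shows "real (N j) / 2 \<le> norm x" "ennreal (norm (pattern (x + n) - g j x) powr p) \<le> \<Phi> x"
proof -
  have zero: "g j x = 0"
  proof (rule ccontr)
    assume "g j x \<noteq> 0"
    then have "(j, n) \<in> active (x + n)" using n x by (simp add: active_def)
    from pattern_active[OF this] neq show False by simp
  qed
  with neq have "pattern (x + n) \<noteq> 0" by simp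
  then obtain i m where im: "(i, m) \<in> active (x + n)" by (rule pattern_nonzeroE)
  have "(i, m) \<noteq> (j, n)" using im zero by (auto simp: active_def)
  then have "real (max (N i) (N j)) \<le> norm (m - n)"
    using im n by (intro lattice_points_separated) (auto simp: active_def)
  moreover have "norm (x + n - m) \<le> R i" using im g_support by (auto simp: active_def)
  moreover have "norm (m - n) \<le> norm x + norm (x + n - m)"
    using norm_triangle_ineq4[of x "x + n - m"] by simp
  ultimately have le: "real (max (N i) (N j)) / 2 \<le> norm x"
    using mesh(1)[of i] by (auto simp: max_def split: if_splits)
  then show "real (N j) / 2 \<le> norm x" by (auto simp: max_def split: if_splits)
  have "norm (pattern (x + n) - g j x) \<le> B i"
    unfolding pattern_active[OF im] zero using g_bound by simp
  moreover have "real (N i) / 2 \<le> norm x" using le by (auto simp: max_def split: if_splits)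
  ultimately show "ennreal (norm (pattern (x + n) - g j x) powr p) \<le> \<Phi> x" by (rule norm_powr_le_\<Phi>)
qed

text \<open>
  The error is dominated by \<open>\<Phi>\<close> and vanishes on the disc of radius \<open>N j / 2\<close>, so it is controlled by a tail
  of the finite measure with density \<open>\<Phi>\<close>.
\<close>

lemma pattern_approximates:
  assumes e: "0 < e"
  obtains J where "\<And>j n. J \<le> j \<Longrightarrow> n \<in> A j \<Longrightarrow> Lp_norm \<mu> p (\<lambda>x. pattern (x + n) - g j x) \<le> e"
proof -
  have \<Phi>m: "\<Phi> \<in> borel_measurable \<mu>" by (rule borel_imp_measurable_mu[OF \<Phi>_borel])
  have fin: "finite_measure (density \<mu> \<Phi>)"
  proof
    have "emeasure (density \<mu> \<Phi>) (space (density \<mu> \<Phi>)) = (\<integral>\<^sup>+x. \<Phi> x * indicator (space \<mu>) x \<partial>\<mu>)"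
      using \<Phi>m by (subst emeasure_density) auto
    also have "\<dots> = (\<integral>\<^sup>+x. \<Phi> x \<partial>\<mu>)" by (rule nn_integral_cong) simp
    finally show "emeasure (density \<mu> \<Phi>) (space (density \<mu> \<Phi>)) \<noteq> \<infinity>" using \<Phi>_integrable by simp
  qed
  have "0 < e powr p" using e by simp
  then obtain r where r: "0 < r" "measure (density \<mu> \<Phi>) {x \<in> S. r \<le> norm x} < e powr p"
    using finite_measure_tail[OF fin, of "e powr p"] sets_far by auto
  obtain J :: nat where J: "2 * r \<le> real J" using real_arch_simple by blast
  show thesis
  proof (rule that[of J])
    fix j n assume j: "J \<le> j" and n: "n \<in> A j"
    have nS: "n \<in> S" using lattice_points_in_sector[OF \<alpha> n] .
    have rN: "r \<le> real (N j) / 2" using J j mesh(2)[of j] by linarith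
    have m: "(\<lambda>x. pattern (x + n) - g j x) \<in> borel_measurable \<mu>"
    proof (intro borel_imp_measurable_mu borel_measurable_diff g_borel)
      show "(\<lambda>x. pattern (x + n)) \<in> borel_measurable borel"
        by (rule measurable_compose[OF _ borel_measurable_pattern]) measurable
    qed
    have "(\<integral>\<^sup>+x. ennreal (norm (pattern (x + n) - g j x) powr p) \<partial>\<mu>)
        \<le> (\<integral>\<^sup>+x. \<Phi> x * indicator {x \<in> S. r \<le> norm x} x \<partial>\<mu>)"
    proof (rule nn_integral_mono)
      fix x assume "x \<in> space \<mu>"
      then have x: "x \<in> S" by simp
      show "ennreal (norm (pattern (x + n) - g j x) powr p) \<le> \<Phi> x * indicator {x \<in> S. r \<le> norm x} x"
        using pattern_near_lattice_point[OF n x] x rN by (cases "pattern (x + n) = g j x") auto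
    qed
    also have "\<dots> = emeasure (density \<mu> \<Phi>) {x \<in> S. r \<le> norm x}"
      using \<Phi>m sets_far by (intro emeasure_density[symmetric])
    also have "\<dots> = ennreal (measure (density \<mu> \<Phi>) {x \<in> S. r \<le> norm x})"
      by (rule finite_measure.emeasure_eq_measure[OF fin])
    also have "\<dots> \<le> ennreal (e powr p)" using r(2) by (intro ennreal_leI) simp
    finally show "Lp_norm \<mu> p (\<lambda>x. pattern (x + n) - g j x) \<le> e"
      using e by (intro Lp_norm_leI(2)[OF m]) auto
  qed
qed

end

context admissible_sector
begin

text \<open>
  The meshes are chosen so large that the mass of \<open>\<mu>\<close> beyond \<open>N j / 2\<close>, weighted with \<open>B j powr p\<close>, is at
  most \<open>2 ^ - j\<close>; then the sum over all \<open>j\<close> of \<open>B j powr p\<close> times the indicator of that region is integrable.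
\<close>

lemma ex_lattice_pattern:
  fixes g :: "nat \<Rightarrow> complex \<Rightarrow> 'k::{real_normed_field,euclidean_space}"
  assumes g: "\<And>j. g j \<in> borel_measurable borel" "\<And>j x. norm (g j x) \<le> B j"
    "\<And>j x. g j x \<noteq> 0 \<Longrightarrow> norm x \<le> R j"
  obtains N \<Phi> where "lattice_pattern \<alpha> \<rho> p M \<omega> g B R N \<Phi>"
proof -
  have "\<exists>N::nat. 2 * R j < real N \<and> j < N \<and> B j powr p * tail (real N / 2) \<le> (1 / 2) ^ j" for j
  proof -
    have "0 < (1 / 2) ^ j / (B j powr p + 1)" by (intro divide_pos_pos add_nonneg_pos) auto
    from tail_small[OF this] obtain r where r: "0 < r" "tail r < (1 / 2) ^ j / (B j powr p + 1)" .
    obtain N :: nat where N: "max (2 * R j) (max (real j) (2 * r)) < real N" using reals_Archimedean2 by blast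
    have "tail (real N / 2) \<le> tail r"
      by (rule finite_measure_mono[OF _ sets_far]) (use N in auto)
    then have "B j powr p * tail (real N / 2) \<le> (B j powr p + 1) * tail r"
      by (intro mult_mono) auto
    also have "\<dots> \<le> (B j powr p + 1) * ((1 / 2) ^ j / (B j powr p + 1))"
      using r(2) by (intro mult_left_mono) auto
    also have "\<dots> = (1 / 2) ^ j"
      using powr_ge_zero[of "B j" p] by (simp add: add_nonneg_eq_0_iff)
    finally show ?thesis using N by (intro exI[of _ N]) auto
  qed
  then have "\<exists>N. \<forall>j. 2 * R j < real (N j) \<and> j < N j \<and> B j powr p * tail (real (N j) / 2) \<le> (1 / 2) ^ j"
    by (intro choice allI)
  then obtain N where N: "\<And>j. 2 * R j < real (N j)" "\<And>j. j < N j"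
    "\<And>j. B j powr p * tail (real (N j) / 2) \<le> (1 / 2) ^ j" by blast
  define \<Phi> where "\<Phi> x = (\<Sum>j. ennreal (B j powr p) * indicator {x. real (N j) / 2 \<le> norm x} x)" for x :: complex
  have ind: "(\<lambda>x. ennreal (B j powr p) * indicator {x. real (N j) / 2 \<le> norm x} x) \<in> borel_measurable borel" for j
    by (intro borel_measurable_times_ennreal borel_measurable_const borel_measurable_indicator
        borel_closed closed_Collect_le continuous_intros)
  have "lattice_pattern \<alpha> \<rho> p M \<omega> g B R N \<Phi>"
  proof unfold_locales
    show "\<Phi> \<in> borel_measurable borel"
      unfolding \<Phi>_def using ind by (rule borel_measurable_suminf_order)
    show "ennreal (B j powr p) \<le> \<Phi> x" if "real (N j) / 2 \<le> norm x" for j x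
    proof -
      have "(\<Sum>j\<in>{j}. ennreal (B j powr p) * indicator {x. real (N j) / 2 \<le> norm x} x) \<le> \<Phi> x"
        unfolding \<Phi>_def by (rule sum_le_suminf) auto
      then show ?thesis using that by simp
    qed
    have "(\<integral>\<^sup>+x. \<Phi> x \<partial>\<mu>)
        = (\<Sum>j. \<integral>\<^sup>+x. ennreal (B j powr p) * indicator {x. real (N j) / 2 \<le> norm x} x \<partial>\<mu>)"
      unfolding \<Phi>_def by (rule nn_integral_suminf) (rule borel_imp_measurable_mu[OF ind])
    also have "\<dots> \<le> (\<Sum>j. ennreal ((1 / 2) ^ j))"
    proof (rule suminf_le)
      fix j
      have "(\<integral>\<^sup>+x. ennreal (B j powr p) * indicator {x. real (N j) / 2 \<le> norm x} x \<partial>\<mu>)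
          = (\<integral>\<^sup>+x. ennreal (B j powr p) * indicator {x \<in> S. real (N j) / 2 \<le> norm x} x \<partial>\<mu>)"
        by (rule nn_integral_cong) (auto simp: indicator_def)
      also have "\<dots> = ennreal (B j powr p) * emeasure \<mu> {x \<in> S. real (N j) / 2 \<le> norm x}"
        by (rule nn_integral_cmult_indicator[OF sets_far])
      also have "\<dots> = ennreal (B j powr p * tail (real (N j) / 2))"
        unfolding emeasure_eq_measure by (simp only: ennreal_mult' powr_ge_zero)
      also have "\<dots> \<le> ennreal ((1 / 2) ^ j)" by (rule ennreal_leI[OF N(3)])
      finally show "(\<integral>\<^sup>+x. ennreal (B j powr p) * indicator {x. real (N j) / 2 \<le> norm x} x \<partial>\<mu>)
          \<le> ennreal ((1 / 2) ^ j)" .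
    qed auto
    also have "\<dots> < \<infinity>" by (subst suminf_ennreal2) (auto intro: summable_geometric)
    finally show "(\<integral>\<^sup>+x. \<Phi> x \<partial>\<mu>) < \<infinity>" .
  qed (use g N in auto)
  then show thesis by (rule that)
qed

text \<open>
  The lower density is bounded from below through measures of subsets, which calls for measurability. By strong continuity the set of times at which
  an orbit is in an open set is relatively open in the sector.
\<close>

lemma sets_orbit_hits:
  fixes u :: "complex \<Rightarrow> 'k::{real_normed_field,euclidean_space}"
  assumes V: "openin (vtopology (Lp_space \<mu> p)) V" and u: "u \<in> Lp_functions \<mu> p"
  shows "{t \<in> S. translation \<alpha> \<rho> p t (Lp_class \<mu> p u) \<in> V} \<in> sets lebesgue" (is "?E \<in> _")
proof -
  interpret C0_semigroup \<alpha> "Lp_space \<mu> p :: ('k, _) normed_module" "translation \<alpha> \<rho> p"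
    by (rule C0_semigroup_translation)
  have "openin (top_of_set S) ?E"
    unfolding openin_euclidean_subtopology_iff
  proof (intro conjI ballI)
    fix t assume t: "t \<in> ?E"
    have "\<forall>\<^sub>F s in at t within S. translation \<alpha> \<rho> p s (Lp_class \<mu> p u) \<in> V"
      using strongly_continuous[OF _ Lp_class_in_carrier[OF u], of t] t V by (auto simp: limitin_def)
    then obtain d where "0 < d" "\<And>s. s \<in> S \<Longrightarrow> s \<noteq> t \<Longrightarrow> dist s t < d \<Longrightarrow> translation \<alpha> \<rho> p s (Lp_class \<mu> p u) \<in> V"
      unfolding eventually_at by blast
    then show "\<exists>e>0. \<forall>s\<in>S. dist s t < e \<longrightarrow> s \<in> ?E"
      using t by (intro exI[of _ d]) auto
  qed auto
  then obtain W where "open W" "?E = S \<inter> W" unfolding openin_open by blast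
  then show ?thesis using S_lebesgue by (simp add: sets.Int)
qed

text \<open>
  A given open set contains a ball around some step function \<open>v\<close>, which is \<open>g j\<close> for an index \<open>j\<close> so large
  that the translates of the pattern by the lattice points \<open>n\<close> of this index are close to \<open>v\<close>. A further
  translation by a small \<open>s\<close> changes \<open>v\<close> only slightly and increases the error by a bounded factor.
\<close>

theorem frequently_hypercyclic_translation:
  "frequently_hypercyclic \<alpha>
     (Lp_space \<mu> p :: ('k::{real_normed_field,euclidean_space}, _) normed_module) (translation \<alpha> \<rho> p)"
proof -
  let ?X = "Lp_space \<mu> p :: ('k, _) normed_module" and ?T = "translation \<alpha> \<rho> p"
  obtain D :: "'k set" where D: "countable D" "\<And>V. open V \<Longrightarrow> V \<noteq> {} \<Longrightarrow> \<exists>d\<in>D. d \<in> V"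
    using countable_dense_exists by blast
  define en where "en = from_nat_into (step_functions D)"
  have range_en: "range en = step_functions D"
    unfolding en_def by (rule range_from_nat_into[OF step_functions_nonempty countable_step_functions[OF D(1)]])
  \<comment> \<open>Every step function occurs with arbitrarily large indices.\<close>
  define g where "g j = en (fst (prod_decode j))" for j
  have g_step: "g j \<in> step_functions D" for j using range_en by (auto simp: g_def)
  have g_borel: "g j \<in> borel_measurable borel" for j
    using g_step[of j] by (auto simp: step_functions_def)
  have "\<exists>B R. (\<forall>x. norm (g j x) \<le> B) \<and> (\<forall>x. g j x \<noteq> 0 \<longrightarrow> norm x \<le> R)" for j
  proof -
    obtain k l where "g j = step_function k l" using g_step[of j] by (auto simp: step_functions_def)
    then show ?thesis using step_function_bounded[of k l] by metis
  qed
  then obtain B R where BR: "\<And>j x. norm (g j x) \<le> B j" "\<And>j x. g j x \<noteq> 0 \<Longrightarrow> norm x \<le> R j" by metis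
  obtain N \<Phi> where pat: "lattice_pattern \<alpha> \<rho> p M \<omega> g B R N \<Phi>"
    using ex_lattice_pattern[OF g_borel BR] .
  interpret lattice_pattern \<alpha> \<rho> p M \<omega> g B R N \<Phi> by (rule pat)
  have "0 < lower_density \<alpha> {t \<in> S. ?T t (Lp_class \<mu> p pattern) \<in> V}"
    if V: "openin (vtopology ?X) V" "V \<noteq> {}" for V
  proof -
    have "V \<subseteq> carrier ?X"
      using openin_subset[OF V(1)] unfolding vtopology_def Metric_space.topspace_mtopology[OF Metric_space_Lp_space] .
    then obtain u where u: "u \<in> Lp_functions \<mu> p" "Lp_class \<mu> p u \<in> V"
      using V(2) unfolding carrier_Lp_space by blast
    obtain d where d: "0 < d"
      "\<And>v. v \<in> Lp_functions \<mu> p \<Longrightarrow> Lp_norm \<mu> p (\<lambda>x. u x - v x) < d \<Longrightarrow> Lp_class \<mu> p v \<in> V"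
      by (rule openin_Lp_space_ball[OF V(1) u(2,1)]) blast
    obtain v where v: "v \<in> step_functions D" "Lp_norm \<mu> p (\<lambda>x. u x - v x) < d"
      using step_functions_dense[OF D(2) u(1) d(1)] by blast
    have vL: "v \<in> Lp_functions \<mu> p" by (rule step_functions_in_Lp[OF v(1)])
    obtain e where e: "0 < e"
      "\<And>w. w \<in> Lp_functions \<mu> p \<Longrightarrow> Lp_norm \<mu> p (\<lambda>x. v x - w x) < e \<Longrightarrow> Lp_class \<mu> p w \<in> V"
      by (rule openin_Lp_space_ball[OF V(1) d(2)[OF vL v(2)] vL]) blast
    define C where "C = growth 1 powr (1 / p)"
    have C: "0 < C" using growth_pos[of 1] by (simp add: C_def)
    have "0 < e / (2 * C)" using e C by simp
    from pattern_approximates[OF this] obtain J where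
      J: "\<And>j n. J \<le> j \<Longrightarrow> n \<in> A j \<Longrightarrow> Lp_norm \<mu> p (\<lambda>x. pattern (x + n) - g j x) \<le> e / (2 * C)" by blast
    obtain i where i: "en i = v" using v(1) unfolding range_en[symmetric] by blast
    define j where "j = prod_encode (i, J)"
    have gj: "g j = v" and Jj: "J \<le> j" using i le_prod_encode_2[of J i] by (auto simp: g_def j_def)
    have "\<forall>\<^sub>F s in at 0 within S. Lp_norm \<mu> p (\<lambda>x. v (x + s) - v (x + 0)) < e / 2"
      using translation_continuous[OF vL sector_0] e(1) by (intro order_tendstoD) auto
    then obtain \<delta>\<^sub>0 where \<delta>\<^sub>0: "0 < \<delta>\<^sub>0" "\<And>s. s \<in> S \<Longrightarrow> s \<noteq> 0 \<Longrightarrow> dist s 0 < \<delta>\<^sub>0 \<Longrightarrow>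
        Lp_norm \<mu> p (\<lambda>x. v (x + s) - v (x + 0)) < e / 2"
      unfolding eventually_at by blast
    define \<delta> where "\<delta> = min \<delta>\<^sub>0 (1 / 2)"
    show ?thesis
    proof (rule lower_density_pos[where N = N and j = j and \<delta> = \<delta>, OF \<alpha> sets_orbit_hits[OF V(1) pattern_in_Lp]])
      show "0 < \<delta>" "\<delta> \<le> 1 / 2" using \<delta>\<^sub>0(1) by (auto simp: \<delta>_def)
      show "0 < N j" using mesh(2)[of j] by simp
      fix n s assume n: "n \<in> lattice_points (sin \<alpha>) N j" and s: "s \<in> S" "norm s < \<delta>"
      have nS: "n \<in> S" by (rule lattice_points_in_sector[OF \<alpha> n])
      have nL: "(\<lambda>x. pattern (x + n)) \<in> Lp_functions \<mu> p"
        by (rule Lp_shift(1)[OF pattern_in_Lp nS order_refl])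
      have vs: "Lp_norm \<mu> p (\<lambda>x. v x - v (x + s)) < e / 2"
      proof (cases "s = 0")
        case True
        then show ?thesis using e(1) by (simp add: Lp_norm_def)
      next
        case False
        then show ?thesis
          using \<delta>\<^sub>0(2)[of s] s Lp_norm_diff_commute[of v "\<lambda>x. v (x + s)"] by (simp add: \<delta>_def)
      qed
      have "norm s \<le> 1" using s by (simp add: \<delta>_def)
      from Lp_shift(2)[OF Lp_diff[OF nL vL] s(1) this]
      have "Lp_norm \<mu> p (\<lambda>x. pattern (x + s + n) - v (x + s)) \<le> C * Lp_norm \<mu> p (\<lambda>x. pattern (x + n) - v x)"
        unfolding C_def .
      also have "\<dots> \<le> C * (e / (2 * C))"
        using J[OF Jj n] C unfolding gj by (intro mult_left_mono) auto
      also have "\<dots> = e / 2" using C by simp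
      finally have ps: "Lp_norm \<mu> p (\<lambda>x. v (x + s) - pattern (x + s + n)) \<le> e / 2"
        using Lp_norm_diff_commute[of "\<lambda>x. v (x + s)" "\<lambda>x. pattern (x + s + n)"] by simp
      have sum: "n + s \<in> S" using nS s by simp
      have pL: "(\<lambda>x. pattern (x + (n + s))) \<in> Lp_functions \<mu> p"
        by (rule Lp_shift(1)[OF pattern_in_Lp sum order_refl])
      have shift: "x + (n + s) = x + s + n" for x by simp
      have "Lp_norm \<mu> p (\<lambda>x. v x - pattern (x + (n + s))) < e"
        using Lp_norm_diff_triangle[OF vL Lp_shift(1)[OF vL s(1) order_refl] pL] vs ps
        unfolding shift by linarith
      then have "?T (n + s) (Lp_class \<mu> p pattern) \<in> V"
        unfolding translation_Lp_class[OF pattern_in_Lp sum] by (rule e(2)[OF pL])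
      then show "n + s \<in> {t \<in> S. ?T t (Lp_class \<mu> p pattern) \<in> V}" using sum by simp
    qed
  qed
  then show ?thesis
    unfolding frequently_hypercyclic_def
    using C0_semigroup_translation Lp_class_in_carrier[OF pattern_in_Lp] by blast
qed

end

theorem theorem3p1:
  fixes \<alpha> p :: real
    and \<rho> :: "complex \<Rightarrow> real"
    and X :: "('k::{real_normed_field,euclidean_space}, (complex \<Rightarrow> 'k) set) normed_module"
    and T :: "complex \<Rightarrow> (complex \<Rightarrow> 'k) set \<Rightarrow> (complex \<Rightarrow> 'k) set"
  assumes "0 < \<alpha>" "\<alpha> \<le> pi / 2"
    and "1 \<le> p"
    and "admissible_weight \<alpha> \<rho>"
    and "X = weighted_Lp \<alpha> \<rho> p"
    and "T = translation \<alpha> \<rho> p"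
    and "(\<integral>\<^sup>+ s. ennreal (\<rho> s) \<partial>lebesgue_on (sector \<alpha>)) < \<infinity>"
  shows "frequent_hypercyclicity_criterion \<alpha> X T \<and> frequently_hypercyclic \<alpha> X T"
proof -
  obtain M \<omega> where "1 \<le> M"
    "\<forall>t\<in>sector \<alpha>. \<forall>t'\<in>sector \<alpha>. \<rho> t \<le> M * exp (\<omega> * norm t') * \<rho> (t + t')"
    using assms(4) by (auto simp: admissible_weight_def)
  then interpret admissible_sector \<alpha> \<rho> p M \<omega>
    using assms by unfold_locales (auto simp: admissible_weight_def)
  have "X = Lp_space (density (lebesgue_on (sector \<alpha>)) (\<lambda>x. ennreal (\<rho> x))) p"
    using assms(5) by (simp add: weighted_Lp_def weighted_measure_def)
  then show ?thesis
    using criterion_translation frequently_hypercyclic_translation assms(6) by simp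
qed

end
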